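(* Let $G$ be a finite, simple, connected graph that contains no subgraph (not necessarily induced) isomorphic to the cycle $C_4$ and no subgraph isomorphic to the cycle $C_5$. Then $G$ is well-dominated if and only if $G$ is well-covered.
   Context: A set $S$ of vertices dominates $G$ if every vertex of $G$ is in $S$ or adjacent to a vertex of $S$; a dominating set is minimal if no proper subset of it is dominating. $G$ is well-dominated if all minimal dominating sets of $G$ have the same cardinality. $G$ is well-covered if all maximal (with respect to inclusion) independent sets of $G$ have the same cardinality. *)

theory Defs
  imports Main
begin

text \<open>A finite simple graph: finite vertex set V and a symmetric, irreflexive
adjacency relation E whose edges lie inside V.\<close>
definition simple_graph :: "'a set \<Rightarrow> ('a \<Rightarrow> 'a \<Rightarrow> bool) \<Rightarrow> bool" where
  "simple_graph V E \<longleftrightarrow> finite V \<and> (\<forall>u v. E u v \<longrightarrow> u \<in> V \<and> v \<in> V)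
     \<and> (\<forall>u v. E u v \<longrightarrow> E v u) \<and> (\<forall>v. \<not> E v v)"

definition connected_graph :: "'a set \<Rightarrow> ('a \<Rightarrow> 'a \<Rightarrow> bool) \<Rightarrow> bool" where
  "connected_graph V E \<longleftrightarrow> V \<noteq> {} \<and> (\<forall>u\<in>V. \<forall>v\<in>V. (u, v) \<in> {(x, y). E x y}\<^sup>*)"

text \<open>G contains a (not necessarily induced) subgraph isomorphic to C4 / C5.\<close>
definition has_C4 :: "'a set \<Rightarrow> ('a \<Rightarrow> 'a \<Rightarrow> bool) \<Rightarrow> bool" where
  "has_C4 V E \<longleftrightarrow> (\<exists>a b c d. distinct [a, b, c, d] \<and> {a, b, c, d} \<subseteq> V \<and>
       E a b \<and> E b c \<and> E c d \<and> E d a)"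

definition has_C5 :: "'a set \<Rightarrow> ('a \<Rightarrow> 'a \<Rightarrow> bool) \<Rightarrow> bool" where
  "has_C5 V E \<longleftrightarrow> (\<exists>a b c d e. distinct [a, b, c, d, e] \<and> {a, b, c, d, e} \<subseteq> V \<and>
       E a b \<and> E b c \<and> E c d \<and> E d e \<and> E e a)"

definition dominating :: "'a set \<Rightarrow> ('a \<Rightarrow> 'a \<Rightarrow> bool) \<Rightarrow> 'a set \<Rightarrow> bool" where
  "dominating V E S \<longleftrightarrow> S \<subseteq> V \<and> (\<forall>v\<in>V. v \<in> S \<or> (\<exists>u\<in>S. E u v))"

definition minimal_dominating :: "'a set \<Rightarrow> ('a \<Rightarrow> 'a \<Rightarrow> bool) \<Rightarrow> 'a set \<Rightarrow> bool" where
  "minimal_dominating V E S \<longleftrightarrow> dominating V E S \<and> (\<forall>T. T \<subset> S \<longrightarrow> \<not> dominating V E T)"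

definition well_dominated :: "'a set \<Rightarrow> ('a \<Rightarrow> 'a \<Rightarrow> bool) \<Rightarrow> bool" where
  "well_dominated V E \<longleftrightarrow> (\<forall>S T. minimal_dominating V E S \<longrightarrow> minimal_dominating V E T
       \<longrightarrow> card S = card T)"

definition independent :: "'a set \<Rightarrow> ('a \<Rightarrow> 'a \<Rightarrow> bool) \<Rightarrow> 'a set \<Rightarrow> bool" where
  "independent V E S \<longleftrightarrow> S \<subseteq> V \<and> (\<forall>u\<in>S. \<forall>v\<in>S. \<not> E u v)"

definition maximal_independent :: "'a set \<Rightarrow> ('a \<Rightarrow> 'a \<Rightarrow> bool) \<Rightarrow> 'a set \<Rightarrow> bool" where
  "maximal_independent V E S \<longleftrightarrow> independent V E S \<and>
       (\<forall>T. independent V E T \<longrightarrow> S \<subseteq> T \<longrightarrow> T = S)"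

definition well_covered :: "'a set \<Rightarrow> ('a \<Rightarrow> 'a \<Rightarrow> bool) \<Rightarrow> bool" where
  "well_covered V E \<longleftrightarrow> (\<forall>S T. maximal_independent V E S \<longrightarrow> maximal_independent V E T
       \<longrightarrow> card S = card T)"

end

theory Submission
  imports Defs
begin

text \<open>Maximal independent sets are minimal dominating, which gives one direction. For the other, note
that deleting the closed neighbourhood of an independent set preserves well-coveredness. By
induction on the number of vertices, a well-covered graph without 4- and 5-cycles either is covered
by the closed neighbourhoods of its simplicial vertices, or some such deletion leaves exactly an
induced 7-cycle. In the covered case the simplices partition the vertices and every minimal
dominating set meets each of them exactly once. In the other case, choose an independent set I
of least size whose deletion leaves a given 7-cycle as a component: if I is empty the connected graph
is the 7-cycle, if I is a single vertex it is the ten-vertex graph of Finbow, Hartnell and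
Nowakowski, and two vertices of I would produce maximal independent sets of different sizes. The two
remaining graphs are settled by inspecting all subsets.\<close>

text \<open>Both forbidden cycles act through two facts: two vertices have at most one common
  neighbour, and vertices two steps away from x, reached through different neighbours of x, are
  distinct and non-adjacent. So one vertex may be picked behind each neighbour of x without checking
  independence, and the choice can be extended to a maximal independent set that avoids x or a whole
  simplex; well-coveredness then gives a contradiction by counting. Excluding non-induced cycles
  passes to every set of vertices under the same \<open>E\<close>, whereas well-coveredness passes
  only to deletions of closed neighbourhoods of independent sets. Hence every auxiliary graph below
  is such a deletion. An induced 7-cycle reached by deletion says little about its surroundings.
  Asking only for a component of what remains, instead of all that remains, lets the deleted set
  shrink until each of its vertices accounts for some attachment to the cycle. The argument then
  concerns one or two deleted vertices.\<close>

locale c45_free =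
  fixes E :: "'a \<Rightarrow> 'a \<Rightarrow> bool"
  assumes E_sym: "E u v \<Longrightarrow> E v u"
    and E_irrefl: "\<not> E v v"
    and no_C4: "\<lbrakk>E a b; E b c; E c d; E d a; a \<noteq> c\<rbrakk> \<Longrightarrow> b = d"
    and no_C5: "\<lbrakk>E a b; E b c; E c d; E d e; E e a; distinct [a, b, c, d, e]\<rbrakk> \<Longrightarrow> False"
begin

lemma E_commute: "E u v \<longleftrightarrow> E v u"
  using E_sym by blast

section \<open>Independent sets and simplices in induced subgraphs\<close>

definition indep :: "'a set \<Rightarrow> bool" where
  "indep S \<longleftrightarrow> (\<forall>u\<in>S. \<forall>v\<in>S. \<not> E u v)"

definition clique :: "'a set \<Rightarrow> bool" where
  "clique K \<longleftrightarrow> (\<forall>u\<in>K. \<forall>v\<in>K. u \<noteq> v \<longrightarrow> E u v)"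

text \<open>Maximality is phrased as domination, which can be checked vertex by vertex and survives
  the union with a deleted independent set.\<close>

definition mis :: "'a set \<Rightarrow> 'a set \<Rightarrow> bool" where
  "mis X S \<longleftrightarrow> S \<subseteq> X \<and> indep S \<and> (\<forall>x\<in>X. x \<in> S \<or> (\<exists>s\<in>S. E s x))"

definition wc :: "'a set \<Rightarrow> bool" where
  "wc X \<longleftrightarrow> finite X \<and> (\<forall>S T. mis X S \<longrightarrow> mis X T \<longrightarrow> card S = card T)"

definition rest :: "'a set \<Rightarrow> 'a set \<Rightarrow> 'a set" where
  "rest X S = {x \<in> X. x \<notin> S \<and> (\<forall>s\<in>S. \<not> E s x)}"

definition nb :: "'a set \<Rightarrow> 'a \<Rightarrow> 'a set" where
  "nb X x = {y \<in> X. y = x \<or> E x y}"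

definition simplicial :: "'a set \<Rightarrow> 'a \<Rightarrow> bool" where
  "simplicial X x \<longleftrightarrow> x \<in> X \<and> clique (nb X x)"

definition simplex_covered :: "'a set \<Rightarrow> 'a set" where
  "simplex_covered X = (\<Union>x \<in> {x. simplicial X x}. nb X x)"

lemma mis_extend:
  assumes "finite X" "S \<subseteq> X" "indep S"
  obtains M where "S \<subseteq> M" "mis X M"
proof -
  let ?F = "{T. S \<subseteq> T \<and> T \<subseteq> X \<and> indep T}"
  have "?F \<subseteq> Pow X" by auto
  then have fin: "finite ?F" using assms(1) by (meson finite_Pow_iff finite_subset)
  have "?F \<noteq> {}" using assms by auto
  from finite_has_maximal[OF fin this]
  obtain M where M: "M \<in> ?F" and max: "\<forall>T\<in>?F. M \<subseteq> T \<longrightarrow> M = T" by blast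
  have "x \<in> M \<or> (\<exists>s\<in>M. E s x)" if "x \<in> X" for x
  proof (rule ccontr)
    assume c: "\<not> (x \<in> M \<or> (\<exists>s\<in>M. E s x))"
    then have "\<forall>s\<in>M. \<not> E s x \<and> \<not> E x s" using E_sym by blast
    then have "indep (insert x M)"
      using M E_irrefl by (auto simp: indep_def)
    then have "insert x M \<in> ?F" using M that by auto
    then have "M = insert x M" using max by (meson subset_insertI)
    moreover have "x \<in> insert x M" by simp
    ultimately show False using c by metis
  qed
  then have "mis X M" using M by (simp add: mis_def)
  then show ?thesis using that[of M] M by simp
qed

lemma mis_finite: "finite X \<Longrightarrow> mis X M \<Longrightarrow> finite M"
  by (meson finite_subset mis_def)

lemma rest_subset: "rest X S \<subseteq> X"
  by (auto simp: rest_def)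

lemma rest_rest: "rest (rest X S) T = rest X (S \<union> T)"
  by (auto simp: rest_def)

lemma mis_rest:
  assumes "S \<subseteq> X" "indep S" "mis (rest X S) T"
  shows "mis X (S \<union> T)" "S \<inter> T = {}"
proof -
  have T: "T \<subseteq> rest X S" "indep T" and dom: "\<forall>x\<in>rest X S. x \<in> T \<or> (\<exists>s\<in>T. E s x)"
    using assms(3) by (auto simp: mis_def)
  show "S \<inter> T = {}" using T(1) by (auto simp: rest_def)
  have "indep (S \<union> T)"
    using T assms(2) E_sym unfolding indep_def rest_def by blast
  moreover have "S \<union> T \<subseteq> X" using assms(1) T(1) by (auto simp: rest_def)
  moreover have "\<forall>x\<in>X. x \<in> S \<union> T \<or> (\<exists>s\<in>S \<union> T. E s x)"
    using dom by (auto simp: rest_def)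
  ultimately show "mis X (S \<union> T)" by (auto simp: mis_def)
qed

lemma wc_finite: "wc X \<Longrightarrow> finite X"
  by (simp add: wc_def)

lemma wc_rest:
  assumes "wc X" "S \<subseteq> X" "indep S"
  shows "wc (rest X S)"
proof -
  have f: "finite X" using assms(1) by (rule wc_finite)
  then have fr: "finite (rest X S)" using rest_subset finite_subset by metis
  have "card T = card T'" if "mis (rest X S) T" "mis (rest X S) T'" for T T'
  proof -
    have fin: "finite S" "finite T" "finite T'"
      using f assms(2) that mis_finite[OF fr] finite_subset by auto
    have "card (S \<union> T) = card (S \<union> T')"
      using mis_rest(1)[OF assms(2,3)] that assms(1) unfolding wc_def by blast
    then show ?thesis
      using mis_rest(2)[OF assms(2,3)] that fin by (simp add: card_Un_disjoint)
  qed
  then show ?thesis using fr unfolding wc_def by blast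
qed

text \<open>The usual source of contradictions: one small maximal independent set bounds every
  independent set, maximal or not.\<close>

lemma indep_card_le:
  assumes "wc X" "mis X M" "S \<subseteq> X" "indep S"
  shows "card S \<le> card M"
proof -
  obtain M' where "S \<subseteq> M'" "mis X M'"
    using mis_extend[OF wc_finite[OF assms(1)] assms(3,4)] .
  then show ?thesis using assms(1,2) mis_finite[OF wc_finite[OF assms(1)]]
    by (metis card_mono wc_def)
qed

text \<open>All maximal independent sets have as many elements as the cover has cliques, and an independent
set meets a clique at most once, so choosing cliques for their elements is always a bijection.\<close>

lemma clique_cover:
  assumes wc: "wc X" and P: "mis X P"
    and cl: "\<And>p. p \<in> P \<Longrightarrow> clique (Q p)"
    and cov: "\<And>x. x \<in> X \<Longrightarrow> \<exists>p\<in>P. x \<in> Q p"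
    and M: "mis X M"
  shows "p \<in> P \<Longrightarrow> M \<inter> Q p \<noteq> {}"
    and "\<lbrakk>m \<in> M; p \<in> P; p' \<in> P; m \<in> Q p; m \<in> Q p'\<rbrakk> \<Longrightarrow> p = p'"
proof -
  have fin: "finite P" "finite M" using wc P M mis_finite wc_finite by auto
  have card: "card M = card P" using wc P M unfolding wc_def by blast
  have sel: "f ` M = P" if f: "\<And>m. m \<in> M \<Longrightarrow> f m \<in> P \<and> m \<in> Q (f m)" for f
  proof -
    have "inj_on f M"
    proof (rule inj_onI)
      fix m m' assume "m \<in> M" "m' \<in> M" "f m = f m'"
      moreover from this have "clique (Q (f m))" "m \<in> Q (f m)" "m' \<in> Q (f m)"
        using f cl by metis+
      ultimately show "m = m'"
        using M unfolding mis_def clique_def indep_def by blast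
    qed
    moreover have "f ` M \<subseteq> P" using f by blast
    ultimately show ?thesis using fin card by (metis card_image card_subset_eq)
  qed
  have "\<forall>m\<in>M. \<exists>p. p \<in> P \<and> m \<in> Q p" using cov M unfolding mis_def by blast
  then obtain f where f: "\<And>m. m \<in> M \<Longrightarrow> f m \<in> P \<and> m \<in> Q (f m)" by metis
  have img: "f ` M = P" by (rule sel[OF f])
  show "M \<inter> Q p \<noteq> {}" if p: "p \<in> P"
  proof -
    obtain m where "m \<in> M" "f m = p" using img p by auto
    then show ?thesis using f[of m] by auto
  qed
  show "p = p'" if h: "m \<in> M" "p \<in> P" "p' \<in> P" "m \<in> Q p" "m \<in> Q p'"
  proof (rule ccontr)
    assume "p \<noteq> p'"
    \<comment> \<open>Redirecting \<open>m\<close> to \<open>p\<close> is again an admissible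
      choice, so some other \<open>n\<close> must be sent to \<open>p'\<close>; then
      \<open>m\<close> and \<open>n\<close> are two independent vertices of the clique
      \<open>Q p'\<close>.\<close>
    let ?g = "f(m := p)"
    have "?g ` M = P"
    proof (rule sel)
      show "?g n \<in> P \<and> n \<in> Q (?g n)" if "n \<in> M" for n
        using f[OF that] h by (cases "n = m") simp_all
    qed
    then obtain n where n: "n \<in> M" "?g n = p'" using h(3) by blast
    then have "n \<noteq> m" using \<open>p \<noteq> p'\<close> by auto
    then have "n \<in> Q p'" using f[OF n(1)] n(2) by auto
    then show False
      using \<open>n \<noteq> m\<close> n(1) h cl[OF h(3)] M unfolding mis_def clique_def indep_def by blast
  qed
qed

section \<open>Simplices and the part of the graph that they leave uncovered\<close>

lemma nb_eq_if_simplicial: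
  assumes "simplicial X x" "simplicial X y" "y \<in> nb X x"
  shows "nb X x = nb X y"
  using assms E_sym unfolding simplicial_def clique_def nb_def by blast

text \<open>Adjacent simplicial vertices span the same simplex, so a maximal independent set of
  simplicial vertices represents every simplex. Being independent, \<open>P\<close> may be deleted
  without losing well-coveredness.\<close>

lemma simplicial_representatives:
  assumes "finite X"
  obtains P where "P \<subseteq> X" "indep P" "\<And>p. p \<in> P \<Longrightarrow> simplicial X p"
    "simplex_covered X = (\<Union>p\<in>P. nb X p)" "rest X P = X - simplex_covered X"
proof -
  let ?S = "{x. simplicial X x}"
  have "finite ?S" using assms by (rule_tac finite_subset[of _ X]) (auto simp: simplicial_def)
  then obtain P where P: "mis ?S P" using mis_extend[of ?S "{}"] by (auto simp: indep_def)
  have "nb X x \<subseteq> (\<Union>p\<in>P. nb X p)" if x: "simplicial X x" for x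
  proof -
    obtain p where "p \<in> P" "x = p \<or> E p x" using P x unfolding mis_def by blast
    moreover have "simplicial X p" using \<open>p \<in> P\<close> P by (auto simp: mis_def)
    ultimately have "nb X x = nb X p"
      using nb_eq_if_simplicial[of X p x] x by (auto simp: nb_def simplicial_def)
    then show ?thesis using \<open>p \<in> P\<close> by blast
  qed
  then have eq: "simplex_covered X = (\<Union>p\<in>P. nb X p)"
    using P unfolding simplex_covered_def mis_def by blast
  moreover have "rest X P = X - (\<Union>p\<in>P. nb X p)"
    by (auto simp: rest_def nb_def)
  moreover have "P \<subseteq> X" "indep P" "\<And>p. p \<in> P \<Longrightarrow> simplicial X p"
    using P by (auto simp: mis_def simplicial_def)
  ultimately show ?thesis using that[of P] by metis
qed

text \<open>The neighbour \<open>y\<close> is not simplicial, since otherwise its simplex would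
  cover \<open>x\<close>. Two non-adjacent neighbours of \<open>y\<close> cannot both be adjacent to
  \<open>x\<close>, because these four vertices would form a 4-cycle.\<close>

lemma child:
  assumes "x \<in> X" "x \<notin> simplex_covered X" "y \<in> X" "E x y"
  obtains z where "z \<in> X" "E y z" "z \<noteq> x" "\<not> E x z"
proof -
  have "\<not> simplicial X y"
    using assms E_sym unfolding simplex_covered_def nb_def by blast
  then obtain a b where ab: "a \<in> X" "b \<in> X" "a = y \<or> E y a" "b = y \<or> E y b" "a \<noteq> b" "\<not> E a b"
    using assms by (auto simp: simplicial_def clique_def nb_def)
  then have ab': "E y a" "E y b" using E_sym by blast+
  show ?thesis
  proof (cases "a \<noteq> x \<and> \<not> E x a \<or> b \<noteq> x \<and> \<not> E x b")
    case True then show ?thesis using that ab ab' by blast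
  next
    case False
    then have "E x a" "E x b" using ab ab' E_sym by blast+
    then show ?thesis using no_C4[of x a y b] ab(5) ab' assms(4) E_irrefl E_sym by blast
  qed
qed

text \<open>Equality would close a 4-cycle through \<open>x\<close>, and an edge would close a
  5-cycle.\<close>

lemma no_edge_between_children:
  assumes "E x y" "E x y'" "y \<noteq> y'" "E y z" "E y' z'" "z \<noteq> x" "z' \<noteq> x" "\<not> E x z" "\<not> E x z'"
  shows "z \<noteq> z'" "\<not> E z z'"
proof -
  show ne: "z \<noteq> z'"
    using no_C4[of x y z y'] assms E_sym by metis
  show "\<not> E z z'"
  proof
    assume "E z z'"
    moreover have "distinct [x, y, z, z', y']" using assms ne E_irrefl by auto
    ultimately show False using no_C5[of x y z z' y'] assms E_sym by blast
  qed
qed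

lemma simplex_covered_subset: "simplex_covered X \<subseteq> X"
  by (auto simp: simplex_covered_def nb_def)

lemma mem_simplex_covered: "simplicial X x \<Longrightarrow> x \<in> simplex_covered X"
  by (auto simp: simplex_covered_def nb_def simplicial_def)

text \<open>A simplicial vertex x of the uncovered part B has a neighbour a outside B. Together with one
child of each other vertex of its simplex, a forms an independent set that keeps every maximal
independent set containing it away from that simplex.\<close>

lemma uncovered_part_not_covered:
  assumes wc: "wc X" and B: "B = X - simplex_covered X" and cov: "simplex_covered B = B"
  shows "B = {}"
proof (rule ccontr)
  assume ne: "B \<noteq> {}"
  have fin: "finite X" using wc by (rule wc_finite)
  obtain P where P: "P \<subseteq> X" "indep P" "\<And>p. p \<in> P \<Longrightarrow> simplicial X p"
    "simplex_covered X = (\<Union>p\<in>P. nb X p)" "rest X P = X - simplex_covered X"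
    using simplicial_representatives[OF fin] by blast
  have "finite B" using fin B by simp
  then obtain PB where PB: "PB \<subseteq> B" "indep PB" "\<And>p. p \<in> PB \<Longrightarrow> simplicial B p"
    "simplex_covered B = (\<Union>p\<in>PB. nb B p)" "rest B PB = B - simplex_covered B"
    using simplicial_representatives by blast
  have "mis B PB" using PB(1,2,5) cov by (auto simp: mis_def rest_def)
  then have mis: "mis X (P \<union> PB)"
    using mis_rest(1)[OF P(1,2)] P(5) B by simp
  obtain x where x: "x \<in> PB" using ne PB(4) cov by blast
  have xB: "x \<in> B" "x \<in> X" "x \<notin> simplex_covered X" using x PB(1) B by auto
  have "\<exists>a. a \<in> X \<and> E x a \<and> a \<notin> B"
  proof (rule ccontr)
    assume "\<not> ?thesis"
    then have "nb X x = nb B x" using xB B by (auto simp: nb_def)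
    then have "simplicial X x" using PB(3)[OF x] xB by (simp add: simplicial_def)
    then show False using xB mem_simplex_covered by blast
  qed
  then obtain a where a: "a \<in> X" "E x a" "a \<notin> B" by blast
  let ?K = "nb B x - {x}"
  have "\<forall>y\<in>?K. \<exists>z. z \<in> X \<and> E y z \<and> z \<noteq> x \<and> \<not> E x z"
  proof
    fix y assume "y \<in> ?K"
    then have "y \<in> X" "E x y" using B by (auto simp: nb_def)
    then show "\<exists>z. z \<in> X \<and> E y z \<and> z \<noteq> x \<and> \<not> E x z"
      using child[OF xB(2,3)] by metis
  qed
  then obtain f where f: "\<And>y. y \<in> ?K \<Longrightarrow> f y \<in> X \<and> E y (f y) \<and> f y \<noteq> x \<and> \<not> E x (f y)"
    by metis
  have K: "E x y" "y \<in> B" if "y \<in> ?K" for y using that by (auto simp: nb_def)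
  have ind: "indep (insert a (f ` ?K))"
  proof -
    \<comment> \<open>Otherwise \<open>x\<close>, \<open>y\<close>, \<open>f y\<close>,
      \<open>a\<close> form a 4-cycle; \<open>a\<close> differs from \<open>y\<close> because only
      \<open>y\<close> lies in \<open>B\<close>.\<close>
    have 1: "\<not> E a (f y)" if y: "y \<in> ?K" for y
      using no_C4[of x y "f y" a] f[OF y] K[OF y] a E_sym by metis
    have 2: "\<not> E (f y) (f y')" if "y \<in> ?K" "y' \<in> ?K" for y y'
      using no_edge_between_children(2)[of x y y' "f y" "f y'"] K f that E_irrefl by metis
    show ?thesis unfolding indep_def using 1 2 E_sym E_irrefl by blast
  qed
  have "insert a (f ` ?K) \<subseteq> X" using a f by blast
  then obtain M where M: "insert a (f ` ?K) \<subseteq> M" "mis X M"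
    using mis_extend[OF fin _ ind] by blast
  have "y \<notin> M" if y: "y \<in> nb B x" for y
  proof (cases "y = x")
    case True then show ?thesis using M a unfolding mis_def indep_def by blast
  next
    case False
    then have "y \<in> ?K" using y by blast
    then have "f y \<in> M" "E y (f y)" using M(1) f by blast+
    then show ?thesis using M unfolding mis_def indep_def by blast
  qed
  then have disj: "M \<inter> nb B x = {}" by blast
  \<comment> \<open>The simplices of \<open>X\<close> at \<open>P\<close> and those of
    \<open>B\<close> at \<open>PB\<close> together cover \<open>X\<close> by cliques, one for each
    element of a maximal independent set. So \<open>M\<close> would have to meet
    \<open>nb B x\<close>, which it avoids.\<close>
  let ?Q = "\<lambda>p. if p \<in> P then nb X p else nb B p"
  have "M \<inter> ?Q x \<noteq> {}"
  proof (rule clique_cover(1)[OF wc mis _ _ M(2)])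
    show "clique (?Q p)" if "p \<in> P \<union> PB" for p
      using that P(3) PB(3) by (auto simp: simplicial_def)
    show "x \<in> P \<union> PB" using x by simp
    show "\<exists>p\<in>P \<union> PB. z \<in> ?Q p" if z: "z \<in> X" for z
    proof (cases "z \<in> B")
      case True
      then obtain p where "p \<in> PB" "z \<in> nb B p" using PB(4) cov by blast
      moreover have "p \<notin> P" using \<open>p \<in> PB\<close> PB(1) P(3) B mem_simplex_covered by blast
      ultimately show ?thesis by (intro bexI[of _ p]) auto
    next
      case False
      then obtain p where "p \<in> P" "z \<in> nb X p" using z B P(4) by auto
      then show ?thesis by (intro bexI[of _ p]) auto
    qed
  qed
  moreover have "x \<notin> P" using xB P(3) mem_simplex_covered by blast
  ultimately show False using disj by simp
qed

lemma common_neighbour_unique: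
  assumes "E a u" "E u b" "E a w" "E w b" "a \<noteq> b"
  shows "u = w"
  using no_C4[OF assms(1,2) assms(4)[THEN E_sym] assms(3)[THEN E_sym] assms(5)] .

section \<open>Reduction to a deletion leaving a 7-cycle\<close>

text \<open>Labels are integers read modulo 7, so that rotating a labelling is a shift of its argument.\<close>

definition cyc7 :: "(int \<Rightarrow> 'a) \<Rightarrow> bool" where
  "cyc7 c \<longleftrightarrow> (\<forall>m n. c m = c n \<longleftrightarrow> m mod 7 = n mod 7) \<and>
     (\<forall>m n. E (c m) (c n) \<longleftrightarrow> (m - n) mod 7 = 1 \<or> (m - n) mod 7 = 6)"

definition cyc7_component :: "'a set \<Rightarrow> (int \<Rightarrow> 'a) \<Rightarrow> bool" where
  "cyc7_component X c \<longleftrightarrow> cyc7 c \<and> range c \<subseteq> X \<and> (\<forall>x\<in>X. \<forall>m. E (c m) x \<longrightarrow> x \<in> range c)"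

lemma int_mod7_cases:
  fixes m :: int
  shows "m mod 7 \<in> {0, 1, 2, 3, 4, 5, 6}"
proof -
  have "0 \<le> m mod 7" "m mod 7 < 7" by simp_all
  then show ?thesis by auto
qed

lemma cyc7I:
  assumes d: "distinct [x0, x1, x2, x3, x4, x5, x6]"
    and n: "\<And>y. y \<in> {x0, x1, x2, x3, x4, x5, x6} \<Longrightarrow> E x0 y \<longleftrightarrow> y = x1 \<or> y = x6"
    "\<And>y. y \<in> {x0, x1, x2, x3, x4, x5, x6} \<Longrightarrow> E x1 y \<longleftrightarrow> y = x0 \<or> y = x2"
    "\<And>y. y \<in> {x0, x1, x2, x3, x4, x5, x6} \<Longrightarrow> E x2 y \<longleftrightarrow> y = x1 \<or> y = x3"
    "\<And>y. y \<in> {x0, x1, x2, x3, x4, x5, x6} \<Longrightarrow> E x3 y \<longleftrightarrow> y = x2 \<or> y = x4"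
    "\<And>y. y \<in> {x0, x1, x2, x3, x4, x5, x6} \<Longrightarrow> E x4 y \<longleftrightarrow> y = x3 \<or> y = x5"
    "\<And>y. y \<in> {x0, x1, x2, x3, x4, x5, x6} \<Longrightarrow> E x5 y \<longleftrightarrow> y = x4 \<or> y = x6"
    "\<And>y. y \<in> {x0, x1, x2, x3, x4, x5, x6} \<Longrightarrow> E x6 y \<longleftrightarrow> y = x5 \<or> y = x0"
  obtains c where "cyc7 c" "range c = {x0, x1, x2, x3, x4, x5, x6}"
proof -
  define c where "c m = [x0, x1, x2, x3, x4, x5, x6] ! nat (m mod 7)" for m :: int
  let ?I = "{0, 1, 2, 3, 4, 5, 6 :: int}"
  have v: "c 0 = x0" "c 1 = x1" "c 2 = x2" "c 3 = x3" "c 4 = x4" "c 5 = x5" "c 6 = x6"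
    by (simp_all add: c_def numeral_eq_Suc)
  have per: "c m = c (m mod 7)" for m by (simp add: c_def)
  have inj: "\<forall>i\<in>?I. \<forall>j\<in>?I. c i = c j \<longleftrightarrow> i = j"
    using d by (simp add: v) metis
  have adj: "\<forall>i\<in>?I. \<forall>j\<in>?I. E (c i) (c j) \<longleftrightarrow> (i - j) mod 7 = 1 \<or> (i - j) mod 7 = 6"
    using d by (simp add: v n) metis
  have "cyc7 c"
    unfolding cyc7_def
  proof (intro conjI allI)
    fix m n
    show "c m = c n \<longleftrightarrow> m mod 7 = n mod 7"
      using inj int_mod7_cases[of m] int_mod7_cases[of n] per by metis
    have "(m - n) mod 7 = (m mod 7 - n mod 7) mod 7" by (simp add: mod_diff_eq)
    then show "E (c m) (c n) \<longleftrightarrow> (m - n) mod 7 = 1 \<or> (m - n) mod 7 = 6"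
      using bspec[OF bspec[OF adj int_mod7_cases[of m]] int_mod7_cases[of n]] per by metis
  qed
  moreover have "range c = {x0, x1, x2, x3, x4, x5, x6}"
  proof
    show "range c \<subseteq> {x0, x1, x2, x3, x4, x5, x6}"
    proof
      fix y assume "y \<in> range c"
      then obtain m where "y = c (m mod 7)" using per by auto
      then show "y \<in> {x0, x1, x2, x3, x4, x5, x6}"
        using int_mod7_cases[of m] v by auto
    qed
    show "{x0, x1, x2, x3, x4, x5, x6} \<subseteq> range c"
      using v by (auto intro: range_eqI[OF sym])
  qed
  ultimately show ?thesis using that by blast
qed

text \<open>Deleting the closed neighbourhood of \<open>v\<close> must have removed a neighbour of
  \<open>p\<close>, since \<open>p\<close> was not simplicial before; so \<open>p\<close> is at
  distance two from \<open>v\<close>. If another vertex \<open>q\<close> of its simplex were too,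
  both would hang from the same neighbour \<open>u\<close> of \<open>v\<close>. Uniqueness of common
  neighbours then shrinks the closed neighbourhood of \<open>p\<close> in \<open>X\<close> to the
  triangle \<open>p\<close>, \<open>q\<close>, \<open>u\<close>, making \<open>p\<close>
  simplicial.\<close>

lemma second_neighbourhood:
  assumes ns: "\<And>x. \<not> simplicial X x" and v: "v \<in> X" and p: "simplicial (rest X {v}) p"
  shows "\<exists>u\<in>X. E v u \<and> E u p"
    and "\<lbrakk>q \<in> nb (rest X {v}) p; q \<noteq> p; u \<in> X; E v u\<rbrakk> \<Longrightarrow> \<not> E u q"
proof -
  let ?Y = "rest X {v}"
  have pY: "p \<in> X" "p \<noteq> v" "\<not> E v p" "clique (nb ?Y p)"
    using p by (auto simp: simplicial_def rest_def)
  show ex: "\<exists>u\<in>X. E v u \<and> E u p"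
  proof (rule ccontr)
    assume "\<not> ?thesis"
    then have "nb X p = nb ?Y p" using pY E_sym by (auto simp: nb_def rest_def)
    then have "simplicial X p" using pY by (simp add: simplicial_def)
    then show False using ns by blast
  qed
  obtain w where w: "w \<in> X" "E v w" "E w p" using ex by blast
  show "\<not> E u q" if q: "q \<in> nb ?Y p" "q \<noteq> p" and u: "u \<in> X" "E v u"
  proof
    assume uq: "E u q"
    have q': "E p q" "q \<noteq> v" "\<not> E v q" "q \<in> X" using q by (auto simp: nb_def rest_def)
    have "u = w"
      using no_edge_between_children(2)[of v w u p q] w u uq q' pY(2,3) by blast
    then have pu: "E u p" using w by simp
    have par: "z = u" if "z \<in> X" "E v z" "E z p" for z
      by (rule common_neighbour_unique[of v z p u]) (use that u pu pY(2) in simp_all)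
    have "nb ?Y p = {p, q}"
    proof -
      have False if "z \<in> nb ?Y p" "z \<noteq> p" "z \<noteq> q" for z
      proof -
        have z: "E p z" "\<not> E v z" using that by (auto simp: nb_def rest_def)
        have "E q z" using that q(1) pY(4) unfolding clique_def by metis
        moreover have "u \<noteq> z" using z(2) u(2) by blast
        ultimately show False
          using common_neighbour_unique[OF pu z(1) uq] q(2) by simp
      qed
      then have "nb ?Y p \<subseteq> {p, q}" by blast
      moreover have "p \<in> nb ?Y p" using p by (simp add: simplicial_def nb_def)
      ultimately show ?thesis using q(1) by blast
    qed
    moreover have "z \<in> insert u (nb ?Y p)" if z: "z \<in> nb X p" for z
    proof (cases "E v z")
      case True
      then have "z \<in> X" "E z p" using z pY(3) E_sym by (auto simp: nb_def)
      then show ?thesis using par True by simp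
    next
      case False
      moreover have "z \<noteq> v" using z pY(2,3) E_commute by (auto simp: nb_def)
      ultimately show ?thesis using z by (auto simp: nb_def rest_def)
    qed
    ultimately have "nb X p \<subseteq> {p, q, u}" by blast
    moreover have "clique {p, q, u}"
      using q'(1) uq pu E_commute by (auto simp: clique_def)
    ultimately have "clique (nb X p)" unfolding clique_def by blast
    then show False using ns pY(1) by (auto simp: simplicial_def)
  qed
qed

text \<open>Every vertex turns out to have degree two, and the simplices left after deleting around
  a vertex are centred at distance two, so nothing is further away than three. This bounds the cycle
  length by 7; lengths 4 and 5 are forbidden, triangles are excluded, and the 6-cycle is not
  well-covered.\<close>

lemma C7_if_no_simplicial:
  assumes wc: "wc X" and ne: "X \<noteq> {}" and ns: "\<And>x. \<not> simplicial X x"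
    and cov: "\<And>v. v \<in> X \<Longrightarrow> simplex_covered (rest X {v}) = rest X {v}"
  obtains c where "cyc7 c" "range c = X"
proof -
  have sec: "simplicial (rest X {v}) y" if h: "v \<in> X" "y \<in> rest X {v}" "u \<in> X" "E v u" "E u y" for v y u
  proof -
    obtain p where p: "simplicial (rest X {v}) p" "y \<in> nb (rest X {v}) p"
      using h(2) cov[OF h(1)] unfolding simplex_covered_def by blast
    then have "y = p" using second_neighbourhood(2)[OF ns h(1) p(1) p(2)] h by blast
    then show ?thesis using p by simp
  qed
  have not_clique: "\<exists>a b. a \<in> nb X y \<and> b \<in> nb X y \<and> a \<noteq> b \<and> \<not> E a b" if "y \<in> X" for y
    using ns[of y] that by (auto simp: simplicial_def clique_def)
  \<comment> \<open>A further neighbour \<open>w\<close> of \<open>p\<close> is adjacent to neither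
    \<open>q\<close> nor \<open>r\<close>, by the 4-cycle condition. After deleting around
    \<open>w\<close>, the vertex \<open>q\<close> is simplicial with \<open>r\<close> in its
    simplex, yet both are at distance two from \<open>w\<close>.\<close>
  have no_tri: False if t: "p \<in> X" "q \<in> X" "r \<in> X" "E p q" "E q r" "E r p" for p q r
  proof -
    obtain w where w: "w \<in> X" "E p w" "w \<noteq> q" "w \<noteq> r"
    proof -
      obtain a b where "a \<in> nb X p" "b \<in> nb X p" "a \<noteq> b" "\<not> E a b" using not_clique t by blast
      then show ?thesis using that t E_sym unfolding nb_def by blast
    qed
    have "\<not> E w q" "\<not> E w r"
      using common_neighbour_unique[of w p q r] common_neighbour_unique[of w p r q] t w E_irrefl
      by (metis E_sym)+
    then have qr: "q \<in> rest X {w}" "r \<in> rest X {w}" using t w by (auto simp: rest_def)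
    have "simplicial (rest X {w}) q"
      by (rule sec[of w q p]) (use qr t w E_sym in blast)+
    moreover have "r \<in> nb (rest X {w}) q" using qr t by (auto simp: nb_def)
    moreover have "r \<noteq> q" using t E_irrefl by blast
    ultimately show False
      using second_neighbourhood(2)[OF ns, of w q r p] w t E_sym by blast
  qed
  \<comment> \<open>With \<open>v\<close> a second neighbour of \<open>a\<close>, the vertex
    \<open>y\<close> becomes simplicial after deleting around \<open>v\<close>, while losing only
    the neighbour \<open>a\<close>. Its other neighbours form a clique, so without triangles there
    is exactly one.\<close>
  have deg: "\<exists>b\<in>X. b \<noteq> a \<and> (\<forall>z\<in>X. E y z \<longleftrightarrow> z = a \<or> z = b)" if y: "y \<in> X" "a \<in> X" "E y a" for y a
  proof -
    have "\<exists>v\<in>X. E a v \<and> v \<noteq> y"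
    proof (rule ccontr)
      assume "\<not> ?thesis"
      then have "nb X a \<subseteq> {a, y}" by (auto simp: nb_def)
      moreover have "clique {a, y}" using y(3) E_sym by (simp add: clique_def)
      ultimately have "simplicial X a" using y(2) unfolding simplicial_def clique_def by blast
      then show False using ns by blast
    qed
    then obtain v where v: "v \<in> X" "E a v" "v \<noteq> y" by blast
    have "\<not> E v y" using no_tri[of a v y] v y E_sym by metis
    then have yv: "y \<in> rest X {v}" using v y by (auto simp: rest_def)
    have sy: "simplicial (rest X {v}) y"
      by (rule sec[of v y a]) (use yv v y E_sym in blast)+
    have one: "z = a \<or> z \<in> rest X {v}" if "z \<in> X" "E y z" for z
    proof (cases "E v z")
      case True then show ?thesis 
        using common_neighbour_unique[of v a y z] v(2,3) y(3) that(2) E_sym by metis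
    next
      case False then show ?thesis using that \<open>\<not> E v y\<close> E_sym by (auto simp: rest_def)
    qed
    have av: "a \<notin> rest X {v}" using v E_sym by (auto simp: rest_def)
    have "\<exists>b\<in>X. E y b \<and> b \<noteq> a"
    proof (rule ccontr)
      assume "\<not> ?thesis"
      then have "nb X y \<subseteq> {y, a}" by (auto simp: nb_def)
      moreover have "clique {y, a}" using y(3) E_sym by (simp add: clique_def)
      ultimately have "simplicial X y" using y(1) unfolding simplicial_def clique_def by blast
      then show False using ns by blast
    qed
    then obtain b where b: "b \<in> X" "E y b" "b \<noteq> a" by blast
    have "z = a \<or> z = b" if z: "z \<in> X" "E y z" for z
    proof (rule ccontr)
      assume n: "\<not> (z = a \<or> z = b)"
      then have "z \<in> nb (rest X {v}) y" "b \<in> nb (rest X {v}) y"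
        using one z b by (auto simp: nb_def)
      then have "E z b" using sy n by (auto simp: simplicial_def clique_def)
      then show False using no_tri[of y z b] y z b E_sym by metis
    qed
    then show ?thesis using b y by blast
  qed
  obtain x0 where x0: "x0 \<in> X" using ne by blast
  obtain x1 where x1: "x1 \<in> X" "E x0 x1"
    using not_clique[OF x0] by (auto simp: nb_def)
  obtain x6 where x6: "x6 \<in> X" "x6 \<noteq> x1" "\<forall>z\<in>X. E x0 z \<longleftrightarrow> z = x1 \<or> z = x6"
    using deg[OF x0 x1] by blast
  have e6: "E x6 x0" using x6 E_sym by blast
  obtain x2 where x2: "x2 \<in> X" "x2 \<noteq> x0" "\<forall>z\<in>X. E x1 z \<longleftrightarrow> z = x0 \<or> z = x2"
    using deg[OF x1(1) x0] x1 E_sym by blast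
  have e12: "E x1 x2" using x2 by blast
  obtain x3 where x3: "x3 \<in> X" "x3 \<noteq> x1" "\<forall>z\<in>X. E x2 z \<longleftrightarrow> z = x1 \<or> z = x3"
    using deg[OF x2(1) x1(1)] e12 E_sym by blast
  obtain x5 where x5: "x5 \<in> X" "x5 \<noteq> x0" "\<forall>z\<in>X. E x6 z \<longleftrightarrow> z = x0 \<or> z = x5"
    using deg[OF x6(1) x0 e6] by blast
  have e65: "E x6 x5" using x5 by blast
  obtain x4 where x4: "x4 \<in> X" "x4 \<noteq> x6" "\<forall>z\<in>X. E x5 z \<longleftrightarrow> z = x6 \<or> z = x4"
    using deg[OF x5(1) x6(1)] e65 E_sym by blast
  have e: "E x2 x3" "E x5 x4" using x3 x4 by blast+
  have n: "\<not> E x0 x2" "\<not> E x0 x5" "x2 \<noteq> x5" "\<not> E x2 x5"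
  proof -
    show 1: "\<not> E x0 x2" using no_tri[of x0 x1 x2] x0 x1 x2 e12 E_sym by metis
    show 2: "\<not> E x0 x5" using no_tri[of x0 x6 x5] x0 x5 x6 e6 e65 E_sym by metis
    have "E x0 x6" using x6 by blast
    then show "x2 \<noteq> x5" "\<not> E x2 x5"
      using no_edge_between_children[of x0 x1 x6 x2 x5] x1 x6 e12 e65 x2 x5 1 2 by blast+
  qed
  \<comment> \<open>The centre of each simplex here is at distance two from \<open>x0\<close>, hence
    \<open>x2\<close> or \<open>x5\<close>, whose only further neighbours are \<open>x3\<close> and
    \<open>x4\<close>.\<close>
  have Y: "rest X {x0} \<subseteq> {x2, x3, x4, x5}"
  proof
    fix z assume z: "z \<in> rest X {x0}"
    then obtain p where p: "simplicial (rest X {x0}) p" "z \<in> nb (rest X {x0}) p"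
      using cov[OF x0] unfolding simplex_covered_def by blast
    obtain u where u: "u \<in> X" "E x0 u" "E u p" using second_neighbourhood(1)[OF ns x0 p(1)] by blast
    have pX: "p \<in> X" "p \<noteq> x0" using p(1) by (auto simp: simplicial_def rest_def)
    then have "p = x2 \<or> p = x5" using u x6 x2 x5 by metis
    moreover have "z \<in> X" "z = p \<or> E p z" "z \<noteq> x1" "z \<noteq> x6"
      using p(2) x6 x1 z by (auto simp: nb_def rest_def)
    ultimately show "z \<in> {x2, x3, x4, x5}" using x3 x4 by blast
  qed
  have XX: "X = {x0, x1, x2, x3, x4, x5, x6}"
  proof
    show "X \<subseteq> {x0, x1, x2, x3, x4, x5, x6}"
    proof
      fix z assume z: "z \<in> X"
      show "z \<in> {x0, x1, x2, x3, x4, x5, x6}"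
      proof (cases "z = x0 \<or> E x0 z")
        case True then show ?thesis using x6(3) z by blast
      next
        case False
        then have "z \<in> rest X {x0}" using z by (simp add: rest_def)
        then show ?thesis using Y by blast
      qed
    qed
  qed (use x0 x1(1) x2(1) x3(1) x4(1) x5(1) x6(1) in simp)
  have d3: "x3 \<noteq> x0" "x3 \<noteq> x2" "x3 \<noteq> x6" "x3 \<noteq> x5" "x4 \<noteq> x0" "x4 \<noteq> x1" "x4 \<noteq> x2" "x4 \<noteq> x5"
    using e e12 e65 n x1 x2 x3 x4 x5 x6 E_sym E_irrefl by metis+
  have d: "x0 \<noteq> x1" "x0 \<noteq> x6" "x1 \<noteq> x2" "x1 \<noteq> x5" "x6 \<noteq> x5" "x6 \<noteq> x2"
    using e e12 e65 e6 n x1 x2 x3 x4 x5 x6 E_sym E_irrefl by metis+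
  \<comment> \<open>Equality would give a 6-cycle, which has maximal independent sets of sizes 2 (an
    antipodal pair) and 3 (every other vertex).\<close>
  have "x3 \<noteq> x4"
  proof
    assume eq: "x3 = x4"
    have n3: "\<forall>z\<in>X. E x3 z \<longleftrightarrow> z = x2 \<or> z = x5"
      using deg[OF x3(1) x2(1)] e eq E_sym n x5(1) by metis
    have "mis X {x0, x3}"
      using x6(3) n3 x1 x3(1) x0 d d3 E_irrefl E_commute[of x3 x0] eq XX
      unfolding mis_def indep_def by auto
    moreover have "mis X {x0, x2, x5}"
      using n e x6(3) e12 e65 x3(1) x4(1) x0 x1 x2(1) x5(1) d d3 E_irrefl
        E_commute[of x2 x0] E_commute[of x5 x0] E_commute[of x5 x2] XX eq
      unfolding mis_def indep_def by auto
    ultimately have "card {x0, x3} = card {x0, x2, x5}" using wc unfolding wc_def by blast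
    then show False using n d d3 x2 x5 by simp
  qed
  obtain w where w: "w \<in> X" "w \<noteq> x2" "\<forall>z\<in>X. E x3 z \<longleftrightarrow> z = x2 \<or> z = w"
    using deg[OF x3(1) x2(1)] e E_sym by blast
  have "w = x4"
  proof -
    have "E x3 w" "E w x3" using w E_sym by blast+
    then show ?thesis using w XX d3 x2 x3 x5 x6 \<open>x3 \<noteq> x4\<close> x4 n E_irrefl by auto
  qed
  then have e34: "E x3 x4" using w by blast
  have n4: "\<forall>z\<in>X. E x4 z \<longleftrightarrow> z = x3 \<or> z = x5"
    using deg[OF x4(1) x5(1)] e e34 E_sym d3 x3(1) by metis
  have n3: "\<forall>z\<in>X. E x3 z \<longleftrightarrow> z = x2 \<or> z = x4" using w(3) \<open>w = x4\<close> by simp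
  have n5: "\<forall>z\<in>X. E x5 z \<longleftrightarrow> z = x4 \<or> z = x6" using x4(3) by blast
  have n6: "\<forall>z\<in>X. E x6 z \<longleftrightarrow> z = x5 \<or> z = x0" using x5(3) by blast
  show ?thesis
  proof (rule cyc7I[of x0 x1 x2 x3 x4 x5 x6])
    show "distinct [x0, x1, x2, x3, x4, x5, x6]"
      using d d3 \<open>x3 \<noteq> x4\<close> n x2 x3 x4 x5 x6 by auto
    show "thesis" if "cyc7 c" "range c = {x0, x1, x2, x3, x4, x5, x6}" for c
      using that XX \<open>\<And>c. cyc7 c \<Longrightarrow> range c = X \<Longrightarrow> thesis\<close> by simp
  qed ((rule bspec[OF x6(3)], simp add: XX), (rule bspec[OF x2(3)], simp add: XX),
      (rule bspec[OF x3(3)], simp add: XX), (rule bspec[OF n3], simp add: XX),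
      (rule bspec[OF n4], simp add: XX), (rule bspec[OF n5], simp add: XX),
      (rule bspec[OF n6], simp add: XX))
qed

lemma indep_Un_rest:
  assumes "indep S" "indep T" "T \<subseteq> rest X S"
  shows "indep (S \<union> T)"
  using assms E_sym unfolding indep_def rest_def by blast

text \<open>With simplicial vertices present, deleting their representatives leaves the uncovered
  part: if that is covered by its own simplices it is empty, and otherwise the induction hypothesis
  finds a cycle inside it. Without any, either the deletion around some vertex is uncovered and the
  induction applies to it, or the whole graph is a 7-cycle. Successive deletions merge into
  one.\<close>

lemma simplex_covered_or_C7:
  assumes "wc X"
  shows "simplex_covered X = X \<or> (\<exists>I c. I \<subseteq> X \<and> indep I \<and> cyc7 c \<and> range c = rest X I)"
  using assms
proof (induction "card X" arbitrary: X rule: less_induct)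
  case less
  have fin: "finite X" using less.prems by (rule wc_finite)
  have lift: "\<exists>I c. I \<subseteq> X \<and> indep I \<and> cyc7 c \<and> range c = rest X I"
    if S: "S \<subseteq> X" "indep S"
      and ex: "\<exists>I c. I \<subseteq> rest X S \<and> indep I \<and> cyc7 c \<and> range c = rest (rest X S) I" for S
  proof -
    obtain I c where I: "I \<subseteq> rest X S" "indep I" "cyc7 c" "range c = rest (rest X S) I"
      using ex by blast
    have "S \<union> I \<subseteq> X" using S I(1) rest_subset[of X S] by blast
    moreover have "indep (S \<union> I)" by (rule indep_Un_rest[OF S(2) I(2,1)])
    ultimately show ?thesis using I(3,4) rest_rest[of X S I] by metis
  qed
  have smaller: "card (rest X S) < card X" if h: "S \<subseteq> X" "S \<noteq> {}" for S
  proof (rule psubset_card_mono[OF fin])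
    obtain s where "s \<in> S" using h by blast
    then have "s \<in> X" "s \<notin> rest X S" using h(1) \<open>s \<in> S\<close> by (auto simp: rest_def)
    then show "rest X S \<subset> X" using rest_subset[of X S] by blast
  qed
  show ?case
  proof (cases "simplex_covered X = {}")
    case True
    then have ns: "\<not> simplicial X x" for x using mem_simplex_covered by blast
    show ?thesis
    proof (cases "\<forall>v\<in>X. simplex_covered (rest X {v}) = rest X {v}")
      case all: True
      show ?thesis
      proof (cases "X = {}")
        case True
        then show ?thesis using \<open>simplex_covered X = {}\<close> by simp
      next
        case False
        obtain c where "cyc7 c" "range c = X"
          using C7_if_no_simplicial[OF less.prems False ns] all by blast
        moreover have "rest X {} = X" "indep {}" by (auto simp: rest_def indep_def)
        ultimately show ?thesis by blast
      qed
    next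
      case False
      then obtain v where v: "v \<in> X" "simplex_covered (rest X {v}) \<noteq> rest X {v}" by blast
      have i: "{v} \<subseteq> X" "indep {v}" using v E_irrefl by (auto simp: indep_def)
      show ?thesis
        using less.hyps[OF smaller[OF i(1)] wc_rest[OF less.prems i]] v(2) lift[OF i] by blast
    qed
  next
    case False
    obtain P where P: "P \<subseteq> X" "indep P" "simplex_covered X = (\<Union>p\<in>P. nb X p)"
      "rest X P = X - simplex_covered X"
      using simplicial_representatives[OF fin] by metis
    then have "P \<noteq> {}" using False by auto
    then consider "simplex_covered (rest X P) = rest X P"
      | "\<exists>I c. I \<subseteq> rest X P \<and> indep I \<and> cyc7 c \<and> range c = rest (rest X P) I"
      using less.hyps[OF smaller[OF P(1)] wc_rest[OF less.prems P(1,2)]] by blast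
    then show ?thesis
    proof cases
      case 1
      then have "X - simplex_covered X = {}"
        using uncovered_part_not_covered[OF less.prems refl] P(4) by simp
      then show ?thesis using simplex_covered_subset by blast
    next
      case 2
      then show ?thesis using lift[OF P(1,2)] by blast
    qed
  qed
qed

section \<open>Arithmetic of labelled 7-cycles\<close>

lemma cyc7_eq: "cyc7 c \<Longrightarrow> c m = c n \<longleftrightarrow> m mod 7 = n mod 7"
  by (simp add: cyc7_def)

lemma cyc7_adj: "cyc7 c \<Longrightarrow> E (c m) (c n) \<longleftrightarrow> (m - n) mod 7 = 1 \<or> (m - n) mod 7 = 6"
  by (simp add: cyc7_def)

lemma cyc7_range:
  assumes "cyc7 c"
  shows "range c = {c 0, c 1, c 2, c 3, c 4, c 5, c 6}"
proof
  show "range c \<subseteq> {c 0, c 1, c 2, c 3, c 4, c 5, c 6}"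
  proof
    fix x assume "x \<in> range c"
    then obtain m where "x = c m" by blast
    then have "x = c (m mod 7)" using cyc7_eq[OF assms] by simp
    then show "x \<in> {c 0, c 1, c 2, c 3, c 4, c 5, c 6}" using int_mod7_cases[of m] by auto
  qed
qed blast

lemma cyc7_shift: "cyc7 c \<Longrightarrow> cyc7 (\<lambda>m. c (s + m))"
proof -
  assume c: "cyc7 c"
  have "(s + m) mod 7 = (s + n) mod 7 \<longleftrightarrow> m mod 7 = n mod 7" for m n :: int
    by (simp add: mod_eq_dvd_iff)
  then show ?thesis unfolding cyc7_def cyc7_eq[OF c] cyc7_adj[OF c] by simp
qed

lemma range_shift: "range (\<lambda>m::int. c (s + m)) = range c"
proof
  show "range c \<subseteq> range (\<lambda>m. c (s + m))"
  proof
    fix x assume "x \<in> range c"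
    then obtain m where "x = c m" by blast
    then have "x = c (s + (m - s))" by simp
    then show "x \<in> range (\<lambda>m. c (s + m))" by blast
  qed
qed blast

section \<open>Vertices attached to a 7-cycle\<close>

lemma mod7_complement:
  fixes m n k :: int
  assumes "(m - n) mod 7 = 7 - k"
  shows "n mod 7 = (m + k) mod 7"
proof -
  have "m - n = 7 * ((m - n) div 7) + (7 - k)"
    using mult_div_mod_eq[of 7 "m - n"] assms by simp
  then have "m + k = n + 7 * ((m - n) div 7 + 1)" by (simp add: algebra_simps)
  then show ?thesis by (metis mod_mult_self2)
qed

text \<open>Attachments at cycle distance two close a 4-cycle and those at distance three a 5-cycle.
  So an outside vertex meets the cycle in at most one vertex or one edge.\<close>

lemma attach_clique:
  assumes c: "cyc7 c" and d: "d \<notin> range c" "E d (c m)" "E d (c n)"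
  shows "(m - n) mod 7 \<in> {0, 1, 6}"
proof (rule ccontr)
  assume "\<not> ?thesis"
  then have cases: "(m - n) mod 7 \<in> {2, 3, 4, 5}" using int_mod7_cases[of "m - n"] by blast
  have two: False if "E d (c i)" "E d (c (i + 2))" for i
  proof -
    have "c (i + 1) = d"
      by (rule common_neighbour_unique[of "c i" _ "c (i + 2)"])
        (use that E_sym in \<open>simp_all add: cyc7_adj[OF c] cyc7_eq[OF c] mod_eq_dvd_iff\<close>)
    then show False using d(1) by blast
  qed
  have three: False if "E d (c i)" "E d (c (i + 3))" for i
  proof -
    have "distinct [d, c i, c (i + 1), c (i + 2), c (i + 3)]"
      using d(1) by (auto simp: cyc7_eq[OF c] mod_eq_dvd_iff)
    then show False
      using no_C5[of d "c i" "c (i + 1)" "c (i + 2)" "c (i + 3)"] that E_sym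
      by (simp add: cyc7_adj[OF c])
  qed
  have e: "c m = c (n + k)" if "(m - n) mod 7 = k" for k
    using that cyc7_eq[OF c] by (metis add.commute diff_add_cancel mod_add_left_eq)
  have e': "c n = c (m + k)" if "(m - n) mod 7 = 7 - k" for k
    unfolding cyc7_eq[OF c] by (rule mod7_complement[OF that])
  show False
    using cases e[of 2] e[of 3] e'[of 3] e'[of 2] two[of n] three[of n] two[of m] three[of m] d(2,3)
    by auto
qed

text \<open>Seen from \<open>v\<close>, the attachment points are children of distinct neighbours,
  hence distinct and non-adjacent.\<close>

lemma attach_disjoint:
  assumes c: "cyc7 c" and v: "v \<notin> range c" "\<And>m. \<not> E v (c m)"
    and d: "E v d" "E v d'" "d \<noteq> d'" "E d (c m)" "E d' (c n)"
  shows "(m - n) mod 7 \<notin> {0, 1, 6}"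
proof -
  have "c m \<noteq> v" "c n \<noteq> v" using v(1) by auto
  then have "c m \<noteq> c n" "\<not> E (c m) (c n)"
    using no_edge_between_children[OF d(1,2,3,4,5)] v(2) by blast+
  moreover have "c m = c n" if "(m - n) mod 7 = 0"
    using that cyc7_eq[OF c] by (simp add: mod_eq_dvd_iff dvd_eq_mod_eq_0)
  ultimately show ?thesis using cyc7_adj[OF c] by auto
qed

lemma third_element:
  assumes "(3 :: nat) \<le> card M"
  obtains w where "w \<in> M" "w \<noteq> a" "w \<noteq> b"
proof -
  have "\<not> M \<subseteq> {a, b}"
  proof
    assume "M \<subseteq> {a, b}"
    then have "card M \<le> card {a, b}" by (simp add: card_mono)
    also have "\<dots> \<le> 2" by (simp add: card_insert_if)
    finally show False using assms by simp
  qed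
  then show ?thesis using that by blast
qed

text \<open>Delete u together with J. What remains is well-covered and consists of the vertices of the
cycle not adjacent to u and of the neighbours of v attached to the cycle that u and J leave
undominated; comparing its maximal independent sets yields w.\<close>

lemma attached_opposite_partner:
  assumes wc: "wc X" and c: "cyc7 c" and comp: "cyc7_component (rest X {v}) c"
    and v: "v \<in> X" and u: "u \<in> X" "E v u" "E u (c 0)"
    and u01: "\<And>m. E u (c m) \<Longrightarrow> m mod 7 \<in> {0, 1}"
    and J: "mis {y \<in> X. y \<notin> range c \<and> \<not> E u y \<and> \<not> (E v y \<and> (\<exists>m. E y (c m)))} J"
  shows "\<exists>w\<in>X. E v w \<and> w \<noteq> u \<and> \<not> E u w \<and> (\<forall>j\<in>J. \<not> E j w) \<and>
    (if E u (c 1) then \<forall>m. E w (c m) \<longleftrightarrow> m mod 7 = 4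
     else \<forall>m. E w (c m) \<longleftrightarrow> m mod 7 \<in> {3, 4})"
proof -
  note cadj = cyc7_adj[OF c] and ceq = cyc7_eq[OF c]
  have C: "c m \<in> X" "c m \<noteq> v" "\<not> E v (c m)" for m
    using comp by (auto simp: cyc7_component_def rest_def)
  have vC: "v \<notin> range c" using C(2) by blast
  have uC: "u \<notin> range c" using u(2) C(3) by blast
  have nbC: "x \<in> range c \<or> E v x" if "x \<in> X" "E (c m) x" for x m
  proof (rule ccontr)
    assume n: "\<not> ?thesis"
    moreover have "x \<noteq> v" using that(2) C(3) E_sym by blast
    ultimately have "x \<in> rest X {v}" using that(1) by (simp add: rest_def)
    then show False using comp that(2) n by (auto simp: cyc7_component_def)
  qed
  have JX: "J \<subseteq> X" "indep J" "\<And>j. j \<in> J \<Longrightarrow> \<not> E u j" "\<And>j. j \<in> J \<Longrightarrow> j \<notin> range c"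
    using J by (auto simp: mis_def)
  have Jc: "\<not> E j (c m)" if j: "j \<in> J" for j m
  proof
    assume e: "E j (c m)"
    then have "E v j" using nbC[of j m] JX(1,4) j E_sym by blast
    then show False using J j e by (auto simp: mis_def)
  qed
  have ind: "indep (insert u J)" using JX(2,3) E_sym E_irrefl unfolding indep_def by blast
  have sub: "insert u J \<subseteq> X" using u JX by blast
  define R where "R = rest X (insert u J)"
  have wcR: "wc R" unfolding R_def by (rule wc_rest[OF wc sub ind])
  have cR: "c m \<in> R \<longleftrightarrow> \<not> E u (c m)" for m
  proof -
    have "c m \<notin> J" "c m \<noteq> u" using JX(4) uC by blast+
    then show ?thesis using C(1) Jc by (auto simp: R_def rest_def)
  qed
  have cR': "c m \<in> R" if "m mod 7 \<notin> {0, 1}" for m using cR u01 that by blast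
  have U: "x \<in> X" "x \<noteq> u" "\<not> E u x" "\<forall>j\<in>J. \<not> E j x" "E v x" "\<exists>m. E x (c m)"
    if x: "x \<in> R" "x \<notin> range c" for x
  proof -
    show 1: "x \<in> X" "x \<noteq> u" "\<not> E u x" "\<forall>j\<in>J. \<not> E j x" using x by (auto simp: R_def rest_def)
    have "E v x \<and> (\<exists>m. E x (c m))"
    proof (rule ccontr)
      assume "\<not> ?thesis"
      then have "x \<in> {y \<in> X. y \<notin> range c \<and> \<not> E u y \<and> \<not> (E v y \<and> (\<exists>m. E y (c m)))}"
        using x(2) 1 by simp
      then have "x \<in> J" using J 1(4) unfolding mis_def by blast
      then show False using x(1) by (simp add: R_def rest_def)
    qed
    then show "E v x" "\<exists>m. E x (c m)" by blast+
  qed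
  have dis: "(m - n) mod 7 \<notin> {0, 1, 6}"
    if "x \<in> R" "x \<notin> range c" "y \<in> R" "y \<notin> range c" "x \<noteq> y" "E x (c m)" "E y (c n)" for x y m n
    by (rule attach_disjoint[OF c vC C(3) U(5)[OF that(1,2)] U(5)[OF that(3,4)] that(5-7)])
  have disu: "(m - n) mod 7 \<notin> {0, 1, 6}"
    if "x \<in> R" "x \<notin> range c" "E u (c m)" "E x (c n)" for x m n
    by (rule attach_disjoint[OF c vC C(3) u(2) U(5)[OF that(1,2)] U(2)[OF that(1,2), symmetric] that(3,4)])
  have per: "E x (c m) \<longleftrightarrow> E x (c (m mod 7))" for x m
    using ceq[of m "m mod 7"] by simp
  have att: "\<not> E x (c 0)" "\<not> E x (c 1)" "\<not> E x (c 6)"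
    "E x (c 2) \<or> E x (c 3) \<or> E x (c 4) \<or> E x (c 5)" if x: "x \<in> R" "x \<notin> range c" for x
  proof -
    show 1: "\<not> E x (c 0)" "\<not> E x (c 1)" "\<not> E x (c 6)"
      using disu[OF x u(3), of 0] disu[OF x u(3), of 1] disu[OF x u(3), of 6] by auto
    obtain m where "E x (c (m mod 7))" using U(6)[OF x] per by blast
    then show "E x (c 2) \<or> E x (c 3) \<or> E x (c 4) \<or> E x (c 5)"
      using int_mod7_cases[of m] 1 by auto
  qed
  have com: "E (c m) x \<longleftrightarrow> E x (c m)" if "x \<notin> range c" for x m by (rule E_commute)
  \<comment> \<open>If \<open>S\<close> already dominates the part of the cycle left in
    \<open>R\<close>, any further member of \<open>M\<close> lies off the cycle and is therefore an
    attached neighbour of \<open>v\<close>.\<close>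
  have new: "w \<notin> range c"
    if M: "mis R M" "w \<in> M" and dom: "\<And>i. c i \<in> R \<Longrightarrow> c i \<notin> S \<Longrightarrow> \<exists>s\<in>S. E s (c i)"
      and S: "S \<subseteq> M" "w \<notin> S" for M w S
  proof
    assume "w \<in> range c"
    then obtain s where "s \<in> S" "E s w" using dom M S unfolding mis_def by blast
    then show False using M S(1) unfolding mis_def indep_def by blast
  qed
  show ?thesis
  proof (cases "E u (c 1)")
    case False
    then have u0: "E u (c m) \<longleftrightarrow> m mod 7 = 0" for m
      using u01[of m] per[of u m] u(3) by auto
    \<comment> \<open>The cycle leaves the path from \<open>c 1\<close> to \<open>c 6\<close>. It is
      dominated by the two vertices \<open>c 2\<close>, \<open>c 5\<close> but contains three
      independent ones, so a vertex off the cycle must make up the difference.\<close>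
    have "indep {c 2, c 5}" "indep {c 1, c 3, c 6}" by (simp_all add: indep_def cadj)
    moreover have "{c 2, c 5} \<subseteq> R" "{c 1, c 3, c 6} \<subseteq> R" by (simp_all add: cR u0)
    ultimately obtain M where M: "{c 2, c 5} \<subseteq> M" "mis R M" and M3: "card {c 1, c 3, c 6} \<le> card M"
      using mis_extend[OF wc_finite[OF wcR]] indep_card_le[OF wcR] by metis
    have dom: "\<exists>s\<in>{c 2, c 5}. E s (c i)" if "c i \<in> R" "c i \<notin> {c 2, c 5}" for i
    proof -
      have "i mod 7 \<in> {1, 3, 4, 6}" using that int_mod7_cases[of i] by (auto simp: cR u0 ceq)
      then have "E (c 2) (c (i mod 7)) \<or> E (c 5) (c (i mod 7))" by (auto simp: cadj)
      then show ?thesis using per by auto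
    qed
    have other: "w \<in> R" "w \<notin> range c" "\<not> E w (c 2)" "\<not> E w (c 5)" "E w (c 3) \<or> E w (c 4)"
      if w: "w \<in> M" "w \<noteq> c 2" "w \<noteq> c 5" for w
    proof -
      show 1: "w \<in> R" using w M by (auto simp: mis_def)
      show 2: "w \<notin> range c" using new[OF M(2) w(1) dom M(1)] w by blast
      show 3: "\<not> E w (c 2)" "\<not> E w (c 5)" using M w(1) by (auto simp: mis_def indep_def)
      show "E w (c 3) \<or> E w (c 4)" using att[OF 1 2] 3 by blast
    qed
    have "3 \<le> card M" using M3 by (simp add: ceq)
    then obtain w where w: "w \<in> M" "w \<noteq> c 2" "w \<noteq> c 5" using third_element by metis
    note ow = other[OF w] and aw = att[OF other(1,2)[OF w]]
    have "w' = w" if w': "w' \<in> M" "w' \<noteq> c 2" "w' \<noteq> c 5" for w'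
    proof (rule ccontr)
      assume "w' \<noteq> w"
      from dis[OF other(1,2)[OF w'] ow(1,2) this] show False
        using other(5)[OF w'] ow(5) by fastforce
    qed
    then have "M = {c 2, c 5, w}" using M(1) w(1) by blast
    then have cM: "card M = 3" using w by (simp add: ceq)
    have small: "\<not> (S \<subseteq> R \<and> indep S \<and> card S = 4)" for S
      using indep_card_le[OF wcR M(2), of S] cM by auto
    have wne: "w \<noteq> c m" for m using ow(2) by blast
    \<comment> \<open>All maximal independent sets of \<open>R\<close> have size 3, so
      \<open>w\<close> must hit each independent triple of the path; its only possible attachments
      are 3 and 4, and each of the two is forced by one triple.\<close>
    have w4: "E w (c 4)"
    proof (rule ccontr)
      assume "\<not> E w (c 4)"
      then have "indep {w, c 1, c 4, c 6}"
        using aw E_irrefl by (simp add: indep_def cadj com[OF ow(2)])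
      moreover have "{w, c 1, c 4, c 6} \<subseteq> R" using ow(1) by (simp add: cR u0)
      moreover have "card {w, c 1, c 4, c 6} = 4" using wne by (simp add: ceq)
      ultimately show False using small by blast
    qed
    have w3: "E w (c 3)"
    proof (rule ccontr)
      assume "\<not> E w (c 3)"
      then have "indep {w, c 1, c 3, c 6}"
        using aw E_irrefl by (simp add: indep_def cadj com[OF ow(2)])
      moreover have "{w, c 1, c 3, c 6} \<subseteq> R" using ow(1) by (simp add: cR u0)
      moreover have "card {w, c 1, c 3, c 6} = 4" using wne by (simp add: ceq)
      ultimately show False using small by blast
    qed
    have "E w (c m) \<longleftrightarrow> m mod 7 \<in> {3, 4}" for m
      using per[of w m] int_mod7_cases[of m] w3 w4 aw(1-3) ow(3,4) by auto
    then show ?thesis using U(1-5)[OF ow(1,2)] False by auto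
  next
    case True
    then have u0: "E u (c m) \<longleftrightarrow> m mod 7 \<in> {0, 1}" for m
      using u01[of m] per[of u m] u(3) by auto
    have att2: "\<not> E x (c 2)" if x: "x \<in> R" "x \<notin> range c" for x
      using disu[OF x True, of 2] by auto
    \<comment> \<open>Now the path runs from \<open>c 2\<close> to \<open>c 6\<close>. It has an
      independent triple but is dominated by either of the pairs \<open>c 3\<close>,
      \<open>c 6\<close> and \<open>c 2\<close>, \<open>c 5\<close>; each pair needs a vertex off
      the cycle, and the two such vertices will coincide.\<close>
    have i3: "indep {c 2, c 4, c 6}" "{c 2, c 4, c 6} \<subseteq> R"
      by (simp_all add: indep_def cadj cR u0)
    have "indep {c 3, c 6}" "indep {c 2, c 5}" by (simp_all add: indep_def cadj)
    moreover have "{c 3, c 6} \<subseteq> R" "{c 2, c 5} \<subseteq> R" by (simp_all add: cR u0)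
    ultimately obtain M N where M: "{c 3, c 6} \<subseteq> M" "mis R M" and N: "{c 2, c 5} \<subseteq> N" "mis R N"
      using mis_extend[OF wc_finite[OF wcR]] by metis
    have "card {c 2, c 4, c 6} \<le> card M" "card {c 2, c 4, c 6} \<le> card N"
      using indep_card_le[OF wcR M(2) i3(2,1)] indep_card_le[OF wcR N(2) i3(2,1)] .
    then have "3 \<le> card M" "3 \<le> card N" by (simp_all add: ceq)
    then obtain w x where w: "w \<in> M" "w \<noteq> c 3" "w \<noteq> c 6" and x: "x \<in> N" "x \<noteq> c 2" "x \<noteq> c 5"
      using third_element by metis
    have domM: "\<exists>s\<in>{c 3, c 6}. E s (c i)" if "c i \<in> R" "c i \<notin> {c 3, c 6}" for i
    proof -
      have "i mod 7 \<in> {2, 4, 5}" using that int_mod7_cases[of i] by (auto simp: cR u0 ceq)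
      then have "E (c 3) (c (i mod 7)) \<or> E (c 6) (c (i mod 7))" by (auto simp: cadj)
      then show ?thesis using per by auto
    qed
    have domN: "\<exists>s\<in>{c 2, c 5}. E s (c i)" if "c i \<in> R" "c i \<notin> {c 2, c 5}" for i
    proof -
      have "i mod 7 \<in> {3, 4, 6}" using that int_mod7_cases[of i] by (auto simp: cR u0 ceq)
      then have "E (c 2) (c (i mod 7)) \<or> E (c 5) (c (i mod 7))" by (auto simp: cadj)
      then show ?thesis using per by auto
    qed
    have wR: "w \<in> R" "w \<notin> range c" and xR: "x \<in> R" "x \<notin> range c"
      using M(2) N(2) w(1) x(1) new[OF M(2) w(1) domM M(1)] new[OF N(2) x(1) domN N(1)] w(2,3) x(2,3)
      by (auto simp: mis_def)
    have w3: "\<not> E w (c 3)" and x5: "\<not> E x (c 5)"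
      using M w(1) N x(1) by (auto simp: mis_def indep_def)
    note aw = att[OF wR] att2[OF wR] and ax = att[OF xR] att2[OF xR]
    have eq: "w = x"
    proof (rule ccontr)
      assume ne: "w \<noteq> x"
      note d = dis[OF wR xR ne]
      have x34: "E x (c 3) \<or> E x (c 4)" using ax x5 by blast
      have "\<not> E w (c 4)" using d[of 4 3] d[of 4 4] x34 by auto
      then have w5: "E w (c 5)" using aw w3 by blast
      then have x3: "E x (c 3)" using d[of 5 4] x34 by auto
      \<comment> \<open>If they differ, \<open>x\<close> is attached at 3 and \<open>w\<close> at 5,
        which leaves no room for another attached vertex; so \<open>c 3\<close> and
        \<open>c 5\<close> dominate all of \<open>R\<close>, one vertex too few.\<close>
      have "mis R {c 3, c 5}"
        unfolding mis_def
      proof (intro conjI ballI)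
        show "{c 3, c 5} \<subseteq> R" "indep {c 3, c 5}" by (simp_all add: indep_def cadj cR u0)
        fix z assume z: "z \<in> R"
        show "z \<in> {c 3, c 5} \<or> (\<exists>s\<in>{c 3, c 5}. E s z)"
        proof (cases "z \<in> range c")
          case True
          then obtain i where i: "z = c (i mod 7)" using ceq by auto
          then have "i mod 7 \<in> {2, 3, 4, 5, 6}" using z int_mod7_cases[of i] by (auto simp: cR u0)
          then show ?thesis unfolding i by (auto simp: cadj)
        next
          case False
          have "z = w \<or> z = x"
          proof (rule ccontr)
            assume n: "\<not> ?thesis"
            then have "\<not> E z (c 3)" "\<not> E z (c 4)" "\<not> E z (c 5)"
              using dis[OF z False xR, of 3 3] dis[OF z False xR, of 4 3]
                dis[OF z False wR, of 5 5] x3 w5 by auto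
            then show False using att[OF z False] att2[OF z False] by blast
          qed
          then show ?thesis using x3 w5 E_sym by blast
        qed
      qed
      from indep_card_le[OF wcR this i3(2,1)] show False by (simp add: ceq)
    qed
    have "E w (c m) \<longleftrightarrow> m mod 7 = 4" for m
      using per[of w m] int_mod7_cases[of m] w3 x5 aw eq by auto
    then show ?thesis using U(1-5)[OF wR] True by auto
  qed
qed

lemma cyc7_component_relabel:
  assumes "cyc7_component X c" "cyc7 c'" "range c' = range c"
  shows "cyc7_component X c'"
proof -
  have "x \<in> range c'" if "x \<in> X" "E (c' m) x" for x m
  proof -
    have "c' m \<in> range c" using assms(3) by blast
    then obtain n where "c' m = c n" by blast
    then show ?thesis using assms that by (auto simp: cyc7_component_def)
  qed
  then show ?thesis using assms by (auto simp: cyc7_component_def)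
qed

lemma normalise_attachment:
  assumes c: "cyc7 c" and u: "u \<notin> range c" "E u (c k)"
  obtains c' where "cyc7 c'" "range c' = range c" "E u (c' 0)" "\<And>m. E u (c' m) \<Longrightarrow> m mod 7 \<in> {0, 1}"
proof -
  \<comment> \<open>Offset 6 is the predecessor: the labelling is to start at the first of the one
    or two consecutive attachments.\<close>
  have "\<exists>i. E u (c i) \<and> (\<forall>m. E u (c (i + m)) \<longrightarrow> m mod 7 \<noteq> 6)"
  proof (cases "\<exists>i. E u (c i) \<and> E u (c (i + 1))")
    case True
    then obtain i where i: "E u (c i)" "E u (c (i + 1))" by blast
    have "m mod 7 \<noteq> 6" if "E u (c (i + m))" for m
    proof
      assume "m mod 7 = 6"
      then have "(m - 1) mod 7 = 5" using mod_diff_left_eq[of m 7 1] by simp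
      then show False using attach_clique[OF c u(1) that i(2)] by simp
    qed
    then show ?thesis using i(1) by blast
  next
    case False
    have "m mod 7 \<noteq> 6" if m: "E u (c (k + m))" for m
    proof
      assume "m mod 7 = 6"
      then have "7 dvd m + 1" using mod_add_left_eq[of m 7 1] by (simp add: dvd_eq_mod_eq_0)
      then have "c (k + m + 1) = c k"
        by (simp add: cyc7_eq[OF c] mod_eq_dvd_iff add.assoc)
      then show False using False m u(2) by metis
    qed
    then show ?thesis using u(2) by blast
  qed
  then obtain i where i: "E u (c i)" "\<And>m. E u (c (i + m)) \<Longrightarrow> m mod 7 \<noteq> 6" by blast
  have "m mod 7 \<in> {0, 1}" if "E u (c (i + m))" for m
    using attach_clique[OF c u(1) that i(1)] i(2)[OF that] by simp
  then show ?thesis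
    using that[of "\<lambda>m. c (i + m)"] cyc7_shift[OF c] range_shift[of c i] i(1) by simp
qed

section \<open>Neighbourhoods of the deleted vertex and of its attached neighbours\<close>

lemma opposite_pair:
  assumes wc: "wc X" and comp: "cyc7_component (rest X {v}) c" and v: "v \<in> X"
    and u: "u \<in> X" "E v u" "E u (c k)"
  obtains c' p p' where "cyc7 c'" "range c' = range c" "p \<in> X" "p' \<in> X" "E v p" "E v p'"
    "p \<noteq> p'" "\<not> E p p'" "\<And>m. E p (c' m) \<longleftrightarrow> m mod 7 = 0" "\<And>m. E p' (c' m) \<longleftrightarrow> m mod 7 \<in> {3, 4}"
proof -
  have c: "cyc7 c" using comp by (simp add: cyc7_component_def)
  have uC: "u \<notin> range c" using comp u(2) by (auto simp: cyc7_component_def rest_def)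
  obtain d where d: "cyc7 d" "range d = range c" "E u (d 0)" "\<And>m. E u (d m) \<Longrightarrow> m mod 7 \<in> {0, 1}"
    using normalise_attachment[OF c uC u(3)] by blast
  let ?Y = "{y \<in> X. y \<notin> range d \<and> \<not> E u y \<and> \<not> (E v y \<and> (\<exists>m. E y (d m)))}"
  have "finite ?Y" using wc_finite[OF wc] by simp
  then obtain J where J: "mis ?Y J" using mis_extend[of ?Y "{}"] by (auto simp: indep_def)
  from attached_opposite_partner[OF wc d(1) cyc7_component_relabel[OF comp d(1,2)] v u(1,2) d(3,4) J]
  obtain w where w: "w \<in> X" "E v w" "w \<noteq> u" "\<not> E u w"
    "if E u (d 1) then \<forall>m. E w (d m) \<longleftrightarrow> m mod 7 = 4 else \<forall>m. E w (d m) \<longleftrightarrow> m mod 7 \<in> {3, 4}"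
    by blast
  have per: "E u (d m) \<longleftrightarrow> E u (d (m mod 7))" for m using cyc7_eq[OF d(1), of m "m mod 7"] by simp
  show ?thesis
  proof (cases "E u (d 1)")
    case False
    then have "E u (d m) \<longleftrightarrow> m mod 7 = 0" for m using d(4)[of m] per[of m] d(3) by auto
    then show ?thesis using that[of d u w] d w u False by auto
  next
    case True
    then have ud: "E u (d m) \<longleftrightarrow> m mod 7 \<in> {0, 1}" for m using d(4)[of m] per[of m] d(3) by auto
    have wd: "E w (d m) \<longleftrightarrow> m mod 7 = 4" for m using True w(5) by simp
    \<comment> \<open>Here \<open>u\<close> holds an edge and \<open>w\<close> the opposite vertex.
      Rotating by 4 moves \<open>w\<close> to label 0 and \<open>u\<close> to the labels 3 and 4, so
      the two exchange roles.\<close>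
    have "(4 + m) mod 7 = 4 \<longleftrightarrow> m mod 7 = 0" "(4 + m) mod 7 \<in> {0, 1} \<longleftrightarrow> m mod 7 \<in> {3, 4}" for m :: int
      using int_mod7_cases[of m] mod_add_right_eq[of 4 m 7] by auto
    then show ?thesis
      using that[of "\<lambda>m. d (4 + m)" w u] cyc7_shift[OF d(1)] range_shift[of d 4] d(2) w(1-4) u(1,2)
      by (simp add: ud wd E_commute)
  qed
qed

text \<open>The component is the ten-vertex graph consisting of a triangle, a further vertex, and three
paths of length three joining that vertex to the vertices of the triangle.\<close>

lemma ten_vertex_component:
  assumes wc: "wc X" and comp: "cyc7_component (rest X {v}) c" and v: "v \<in> X"
    and p: "p \<in> X" "p' \<in> X" "E v p" "E v p'" "p \<noteq> p'" "\<not> E p p'"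
    and pc: "\<And>m. E p (c m) \<longleftrightarrow> m mod 7 = 0" and pc': "\<And>m. E p' (c m) \<longleftrightarrow> m mod 7 \<in> {3, 4}"
  shows "x \<in> X \<Longrightarrow> E v x \<longleftrightarrow> x = p \<or> x = p'"
    and "x \<in> X \<Longrightarrow> E p x \<longleftrightarrow> x = v \<or> x = c 0"
    and "x \<in> X \<Longrightarrow> E p' x \<longleftrightarrow> x = v \<or> x = c 3 \<or> x = c 4"
proof -
  have c: "cyc7 c" using comp by (simp add: cyc7_component_def)
  have fin: "finite X" using wc by (rule wc_finite)
  note cadj = cyc7_adj[OF c] and ceq = cyc7_eq[OF c]
  have C: "c m \<in> X" "c m \<noteq> v" "\<not> E v (c m)" for m
    using comp by (auto simp: cyc7_component_def rest_def)
  have vC: "v \<notin> range c" using C(2) by blast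
  have per: "E x (c m) \<longleftrightarrow> E x (c (m mod 7))" for x m
    using ceq[of m "m mod 7"] by simp
  \<comment> \<open>A third attached neighbour of \<open>v\<close> must keep away from 0, 3, 4 and
    all labels next to them, which are all seven.\<close>
  have D: "d = p \<or> d = p'" if d: "E v d" "E d (c m)" for d m
  proof (rule ccontr)
    assume n: "\<not> ?thesis"
    have dm: "E d (c (m mod 7))" using d(2) per by blast
    have "E p (c 0)" "E p' (c 3)" "E p' (c 4)" by (simp_all add: pc pc')
    then have "(0 - m mod 7) mod 7 \<notin> {0, 1, 6}" "(3 - m mod 7) mod 7 \<notin> {0, 1, 6}"
      "(4 - m mod 7) mod 7 \<notin> {0, 1, 6}"
      using attach_disjoint[OF c vC C(3) p(3) d(1) _ _ dm] attach_disjoint[OF c vC C(3) p(4) d(1) _ _ dm] n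
      by metis+
    then show False using int_mod7_cases[of m] by auto
  qed
  have common: "x = v" if "E p x" "E p' x" for x
    using common_neighbour_unique[of p x p' v] that p E_sym by metis
  \<comment> \<open>An extra neighbour \<open>x\<close> of \<open>p'\<close> can be put into
    \<open>J\<close>. The partner of \<open>p\<close> is then non-adjacent to \<open>x\<close>, but
    its attachments make it \<open>p'\<close>.\<close>
  have nb': "x = v \<or> x \<in> range c" if x: "x \<in> X" "E p' x" for x
  proof (rule ccontr)
    assume n: "\<not> ?thesis"
    let ?Y = "{y \<in> X. y \<notin> range c \<and> \<not> E p y \<and> \<not> (E v y \<and> (\<exists>m. E y (c m)))}"
    have "\<not> E p x" using common x n by blast
    moreover have "x \<noteq> p" "x \<noteq> p'" using x(2) p(6) E_sym E_irrefl by blast+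
    ultimately have sY: "{x} \<subseteq> ?Y" using D n x(1) by blast
    have fY: "finite ?Y" "indep {x}" using fin E_irrefl by (simp_all add: indep_def)
    obtain J where J: "{x} \<subseteq> J" "mis ?Y J" using mis_extend[OF fY(1) sY fY(2)] by blast
    have "E p (c 0)" "\<not> E p (c 1)" "\<And>m. E p (c m) \<Longrightarrow> m mod 7 \<in> {0, 1}" by (simp_all add: pc)
    with attached_opposite_partner[OF wc c comp v p(1,3) _ _ J(2)]
    obtain w where w: "E v w" "w \<noteq> p" "\<forall>j\<in>J. \<not> E j w" "\<forall>m. E w (c m) \<longleftrightarrow> m mod 7 \<in> {3, 4}"
      by auto
    have "E w (c 3)" using w(4) by simp
    then have "w = p'" using D w(1,2) by blast
    then show False using w(3) J(1) x(2) E_sym by blast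
  qed
  have nb: "x = v \<or> x \<in> range c" if x: "x \<in> X" "E p x" for x
  proof (rule ccontr)
    assume n: "\<not> ?thesis"
    \<comment> \<open>Rotated by 3, \<open>p'\<close> is attached at 0 and 1, and the previous
      argument applies with the roles exchanged: the partner sits at label 4, that is at
      \<open>c 7 = c 0\<close>, and is \<open>p\<close>.\<close>
    define d where "d = (\<lambda>m. c (3 + m))"
    have d: "cyc7 d" "range d = range c"
      unfolding d_def using cyc7_shift[OF c] range_shift[of c 3] by simp_all
    let ?Y = "{y \<in> X. y \<notin> range d \<and> \<not> E p' y \<and> \<not> (E v y \<and> (\<exists>m. E y (d m)))}"
    have "\<not> E p' x" using common x n by blast
    moreover have "x \<noteq> p" "x \<noteq> p'" using x(2) p(6) E_sym E_irrefl by blast+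
    ultimately have sY: "{x} \<subseteq> ?Y" using D n x(1) d(2) unfolding d_def by blast
    have fY: "finite ?Y" "indep {x}" using fin E_irrefl by (simp_all add: indep_def)
    obtain J where J: "{x} \<subseteq> J" "mis ?Y J" using mis_extend[OF fY(1) sY fY(2)] by blast
    have "(3 + m) mod 7 \<in> {3, 4} \<longleftrightarrow> m mod 7 \<in> {0, 1}" for m :: int
      using int_mod7_cases[of m] mod_add_right_eq[of 3 m 7] by auto
    then have "E p' (d m) \<longleftrightarrow> m mod 7 \<in> {0, 1}" for m by (simp add: d_def pc')
    then have "E p' (d 0)" "E p' (d 1)" "\<And>m. E p' (d m) \<Longrightarrow> m mod 7 \<in> {0, 1}" by simp_all
    with attached_opposite_partner[OF wc d(1) cyc7_component_relabel[OF comp d] v p(2,4) _ _ J(2)]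
    obtain w where w: "E v w" "w \<noteq> p'" "\<forall>j\<in>J. \<not> E j w" "\<forall>m. E w (d m) \<longleftrightarrow> m mod 7 = 4"
      by auto
    have "E w (c 7)" using w(4)[rule_format, of 4] by (simp add: d_def)
    then have "w = p" using D w(1,2) by blast
    then show False using w(3) J(1) x(2) E_sym by blast
  qed
  show np: "E p x \<longleftrightarrow> x = v \<or> x = c 0" if x: "x \<in> X" for x
  proof -
    have "E p x \<Longrightarrow> x \<in> range c \<Longrightarrow> x = c 0" using pc ceq by auto
    then show ?thesis using nb[OF x] p(3) pc[of 0] E_sym by auto
  qed
  show np': "E p' x \<longleftrightarrow> x = v \<or> x = c 3 \<or> x = c 4" if x: "x \<in> X" for x
  proof -
    have "E p' x \<Longrightarrow> x \<in> range c \<Longrightarrow> x = c 3 \<or> x = c 4" using pc' ceq by auto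
    then show ?thesis using nb'[OF x] p(4) pc'[of 3] pc'[of 4] E_sym by auto
  qed
  show "E v x \<longleftrightarrow> x = p \<or> x = p'" if x: "x \<in> X" for x
  proof (rule iffI, rule ccontr)
    assume e: "E v x" and n: "\<not> (x = p \<or> x = p')"
    \<comment> \<open>Choosing \<open>J\<close> through the extra neighbour \<open>x\<close> keeps
      \<open>v\<close> out of \<open>J\<close>, so deleting \<open>J\<close> leaves exactly the
      cycle with \<open>p\<close> and \<open>p'\<close>. That graph has a maximal independent set of
      size 3 and an independent set of size 4.\<close>
    let ?Y = "{y \<in> X. y \<notin> range c \<and> y \<noteq> p \<and> y \<noteq> p'}"
    have xc: "x \<notin> range c" using e C(3) by blast
    then have sY: "{x} \<subseteq> ?Y" using x n by simp
    have fY: "finite ?Y" "indep {x}" using fin E_irrefl by (simp_all add: indep_def)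
    obtain J where J: "{x} \<subseteq> J" "mis ?Y J" using mis_extend[OF fY(1) sY fY(2)] by blast
    have JX: "J \<subseteq> X" "indep J" using J(2) by (auto simp: mis_def)
    have Jn: "j \<in> X" "j \<notin> range c" "j \<noteq> p" "j \<noteq> p'" "j \<noteq> v" "\<not> E j p" "\<not> E j p'" "\<not> E j (c m)"
      if j: "j \<in> J" for j m
    proof -
      show 1: "j \<in> X" "j \<notin> range c" "j \<noteq> p" "j \<noteq> p'" using j J(2) by (auto simp: mis_def)
      show 2: "j \<noteq> v" using J j e JX(2) by (auto simp: indep_def)
      show "\<not> E j p" "\<not> E j p'" using nb[of j] nb'[of j] 1 2 E_sym by blast+
      show "\<not> E j (c m)"
      proof
        assume "E j (c m)"
        then have "E v j \<or> j \<in> range c"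
          using comp 1(1) 2 E_sym[of j "c m"] unfolding cyc7_component_def rest_def by blast
        then show False using D \<open>E j (c m)\<close> 1 by blast
      qed
    qed
    define R where "R = rest X J"
    have wcR: "wc R" unfolding R_def by (rule wc_rest[OF wc JX])
    have R: "R = insert p (insert p' (range c))"
    proof
      show "R \<subseteq> insert p (insert p' (range c))"
        using J(2) unfolding R_def rest_def mis_def by blast
      show "insert p (insert p' (range c)) \<subseteq> R"
        using Jn C p unfolding R_def rest_def by blast
    qed
    have pr: "p \<notin> range c" "p' \<notin> range c" using p(3,4) C(3) by blast+
    have com: "E (c m) p \<longleftrightarrow> E p (c m)" "E (c m) p' \<longleftrightarrow> E p' (c m)" "E p' p \<longleftrightarrow> E p p'" for m
      using E_commute by blast+
    have "indep {p, p', c 1, c 5}" "indep {c 0, c 3, c 5}"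
      using p(6) E_irrefl by (simp_all add: indep_def cadj com pc pc')
    moreover have "\<forall>z\<in>R. z \<in> {c 0, c 3, c 5} \<or> (\<exists>s\<in>{c 0, c 3, c 5}. E s z)"
      unfolding R cyc7_range[OF c] by (simp add: cadj com pc pc')
    ultimately have "card {p, p', c 1, c 5} \<le> card {c 0, c 3, c 5}"
      using indep_card_le[OF wcR, of "{c 0, c 3, c 5}" "{p, p', c 1, c 5}"] R by (auto simp: mis_def)
    moreover have "p \<noteq> c m" "p' \<noteq> c m" for m using pr by blast+
    ultimately show False using p(5) by (simp add: ceq)
  qed (use p in blast)
qed

section \<open>Two vertices attached to the same 7-cycle\<close>

text \<open>Attachment points at distance one would give a 4-cycle, at distance two a 5-cycle. Equal
  points and distance three remain possible.\<close>

lemma attached_adjacent: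
  assumes c: "cyc7 c" and x: "x \<notin> range c" "y \<notin> range c" "E x y" "E x (c m)" "E y (c n)"
  shows "(m - n) mod 7 \<notin> {1, 2, 5, 6}"
proof
  assume d: "(m - n) mod 7 \<in> {1, 2, 5, 6}"
  have one: False if "E z (c i)" "E w (c (i + 1))" "E z w" "z \<notin> range c" "w \<notin> range c" for z w i
  proof -
    have "c i = w"
      by (rule common_neighbour_unique[of z _ "c (i + 1)"])
        (use that E_sym in \<open>auto simp: cyc7_adj[OF c]\<close>)
    then show False using that by blast
  qed
  have two: False if "E z (c i)" "E w (c (i + 2))" "E z w" "z \<notin> range c" "w \<notin> range c" for z w i
  proof -
    have "distinct [z, c i, c (i + 1), c (i + 2), w]"
      using that E_irrefl by (auto simp: cyc7_eq[OF c] mod_eq_dvd_iff)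
    then show False
      using no_C5[of z "c i" "c (i + 1)" "c (i + 2)" w] that E_sym
      by (simp add: cyc7_adj[OF c])
  qed
  have e: "c m = c (n + k)" if "(m - n) mod 7 = k" for k
    using that cyc7_eq[OF c] by (metis add.commute diff_add_cancel mod_add_left_eq)
  have e': "c n = c (m + k)" if "(m - n) mod 7 = 7 - k" for k
    unfolding cyc7_eq[OF c] by (rule mod7_complement[OF that])
  show False
    using d e[of 1] e[of 2] e'[of 1] e'[of 2] one[of y n x] one[of x m y] two[of y n x] two[of x m y] x E_sym
    by auto
qed

text \<open>One arm from \<open>v\<close> reaches a vertex of the cycle and the other the opposite
  edge. The offset \<open>s\<close> allows two such attachments to be compared in one common
  labelling.\<close>

definition opposite_attachment :: "'a set \<Rightarrow> (int \<Rightarrow> 'a) \<Rightarrow> 'a \<Rightarrow> 'a \<Rightarrow> 'a \<Rightarrow> int \<Rightarrow> bool" where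
  "opposite_attachment X c v p p' s \<longleftrightarrow> p \<in> X \<and> p' \<in> X \<and> (\<forall>x\<in>X. E v x \<longleftrightarrow> x = p \<or> x = p') \<and>
     (\<forall>x\<in>X. E p x \<or> E p' x \<longrightarrow> x = v \<or> x \<in> range c) \<and>
     (\<forall>m. E p (c m) \<longleftrightarrow> (m - s) mod 7 = 0) \<and> (\<forall>m. E p' (c m) \<longleftrightarrow> (m - s) mod 7 \<in> {3, 4})"

text \<open>Besides the 13 named vertices there are at most one common neighbour x of i and j, and
vertices adjacent to no named vertex. A fixed maximal independent set J of the latter can be
extended by i, j and three vertices of the cycle, so no independent set of named vertices and x
extends J by 6 vertices, and no maximal one by 4; one of these occurs for each s > 0, and s = 0 gives a 4-cycle.\<close>

lemma not_two_opposite_attachments: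
  assumes wc: "wc X" and comp: "cyc7_component (rest X {i, j}) c"
    and ij: "i \<in> X" "j \<in> X" "i \<noteq> j" "\<not> E i j"
    and at_i: "opposite_attachment (rest X {j}) c i p p' 0"
    and at_j: "opposite_attachment (rest X {i}) c j q q' s"
    and s: "s \<in> {0, 1, 2, 3}"
  shows False
proof -
  have c: "cyc7 c" using comp by (simp add: cyc7_component_def)
  have fin: "finite X" using wc by (rule wc_finite)
  note cadj = cyc7_adj[OF c] and ceq = cyc7_eq[OF c]
  have C: "c m \<in> X" "c m \<noteq> i" "c m \<noteq> j" "\<not> E i (c m)" "\<not> E j (c m)" for m
    using comp by (auto simp: cyc7_component_def rest_def)
  have Ci: "i \<notin> range c" "j \<notin> range c" using C(2,3) by blast+
  have P: "p \<in> X" "p' \<in> X" "p \<noteq> j" "p' \<noteq> j" "\<not> E j p" "\<not> E j p'"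
    using at_i by (auto simp: opposite_attachment_def rest_def)
  have Q: "q \<in> X" "q' \<in> X" "q \<noteq> i" "q' \<noteq> i" "\<not> E i q" "\<not> E i q'"
    using at_j by (auto simp: opposite_attachment_def rest_def)
  have ip: "E i p" "E i p'" and jq: "E j q" "E j q'"
    using at_i at_j by (auto simp: opposite_attachment_def)
  have pc: "E p (c m) \<longleftrightarrow> m mod 7 = 0" "E p' (c m) \<longleftrightarrow> m mod 7 \<in> {3, 4}" for m
    using at_i by (auto simp: opposite_attachment_def)
  have qc: "E q (c m) \<longleftrightarrow> (m - s) mod 7 = 0" "E q' (c m) \<longleftrightarrow> (m - s) mod 7 \<in> {3, 4}" for m
    using at_j by (auto simp: opposite_attachment_def)
  have nC: "p \<notin> range c" "p' \<notin> range c" "q \<notin> range c" "q' \<notin> range c" using ip jq C(4,5) by blast+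
  have ne: "p \<noteq> p'" "q \<noteq> q'" "p \<noteq> q" "p \<noteq> q'" "p' \<noteq> q" "p' \<noteq> q'" "p \<noteq> i" "p' \<noteq> i" "q \<noteq> j" "q' \<noteq> j"
    using pc[of 0] qc[of s] ip jq Q P E_irrefl by auto
  have pin: "x = i \<or> x \<in> range c" if "x \<in> X" "x \<noteq> j" "\<not> E j x" "E p x \<or> E p' x" for x
    using at_i that by (auto simp: opposite_attachment_def rest_def)
  have qin: "x = j \<or> x \<in> range c" if "x \<in> X" "x \<noteq> i" "\<not> E i x" "E q x \<or> E q' x" for x
    using at_j that by (auto simp: opposite_attachment_def rest_def)
  have pp: "\<not> E p p'" and qq: "\<not> E q q'"
    using pin[of p'] qin[of q'] P Q ne nC by blast+
  define Z where "Z = {x \<in> X. E i x \<and> E j x}"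
  define Y where "Y = rest X {i, j} - range c"
  have XK: "X = {i, j, p, p', q, q'} \<union> range c \<union> Z \<union> Y"
  proof
    show "X \<subseteq> {i, j, p, p', q, q'} \<union> range c \<union> Z \<union> Y"
    proof
      fix x assume x: "x \<in> X"
      have "x = p \<or> x = p'" if "x \<noteq> j" "\<not> E j x" "E i x"
        using at_i that x by (auto simp: opposite_attachment_def rest_def)
      moreover have "x = q \<or> x = q'" if "x \<noteq> i" "\<not> E i x" "E j x"
        using at_j that x by (auto simp: opposite_attachment_def rest_def)
      moreover have "x \<in> range c \<union> Y" if "x \<noteq> i" "x \<noteq> j" "\<not> E i x" "\<not> E j x"
        using x that by (simp add: Y_def rest_def)
      ultimately show "x \<in> {i, j, p, p', q, q'} \<union> range c \<union> Z \<union> Y"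
        using x unfolding Z_def by blast
    qed
  qed (use ij P(1,2) Q(1,2) C(1) in \<open>auto simp: Z_def Y_def rest_def\<close>)
  have Y: "y \<in> X" "y \<notin> range c" "y \<noteq> i" "y \<noteq> j" "\<not> E i y" "\<not> E j y" "\<not> E p y" "\<not> E p' y" "\<not> E q y" "\<not> E q' y"
    "\<not> E (c m) y" if y: "y \<in> Y" for y m
  proof -
    show 1: "y \<in> X" "y \<notin> range c" "y \<noteq> i" "y \<noteq> j" "\<not> E i y" "\<not> E j y"
      using y by (auto simp: Y_def rest_def)
    show "\<not> E p y" "\<not> E p' y" "\<not> E q y" "\<not> E q' y" using pin[of y] qin[of y] 1 by blast+
    show "\<not> E (c m) y" using y comp by (auto simp: Y_def cyc7_component_def)
  qed
  have Z1: "x = x'" if "x \<in> Z" "x' \<in> Z" for x x'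
    using common_neighbour_unique[of i x j x'] that ij(3) E_sym by (simp add: Z_def)
  have Zne: "x \<in> X" "x \<noteq> p" "x \<noteq> p'" "x \<noteq> q" "x \<noteq> q'" "x \<noteq> i" "x \<noteq> j" "x \<notin> range c" if "x \<in> Z" for x
    using that P Q C(4) E_irrefl by (auto simp: Z_def)
  have Zc: "\<not> E x (c m)" if x: "x \<in> Z" for x m
  proof
    assume e: "E x (c m)"
    have "c m = c (m mod 7)" by (simp add: ceq)
    then have em: "E x (c (m mod 7))" using e by simp
    have "E i x" using x by (simp add: Z_def)
    note d = attach_disjoint[OF c Ci(1) C(4) _ this _ _ em]
    have "(0 - m mod 7) mod 7 \<notin> {0, 1, 6}" "(3 - m mod 7) mod 7 \<notin> {0, 1, 6}"
      "(4 - m mod 7) mod 7 \<notin> {0, 1, 6}"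
      using d[OF ip(1), of 0] d[OF ip(2), of 3] d[OF ip(2), of 4] Zne(2,3)[OF x] by (auto simp: pc)
    then show False using int_mod7_cases[of m] by auto
  qed
  have finY: "finite Y" using fin by (simp add: Y_def rest_def)
  obtain J where J: "mis Y J" and JZ: "\<And>x. x \<in> Z \<Longrightarrow> (\<exists>y\<in>Y. E x y) \<Longrightarrow> \<exists>y\<in>J. E x y"
  proof (cases "\<exists>x\<in>Z. \<exists>y\<in>Y. E x y")
    case True
    then obtain x y where xy: "x \<in> Z" "y \<in> Y" "E x y" by blast
    have "{y} \<subseteq> Y" "indep {y}" using xy E_irrefl by (simp_all add: indep_def)
    from mis_extend[OF finY this] obtain J where "{y} \<subseteq> J" "mis Y J" by blast
    then show ?thesis using that[of J] xy Z1 by blast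
  next
    case False
    have "{} \<subseteq> Y" "indep {}" by (simp_all add: indep_def)
    from mis_extend[OF finY this] obtain J where "mis Y J" by blast
    then show ?thesis using that[of J] False by blast
  qed
  have JY: "J \<subseteq> Y" "indep J" "finite J" using J mis_finite[OF finY J] by (auto simp: mis_def)
  let ?N = "{i, j, p, p', q, q', c 0, c 1, c 2, c 3, c 4, c 5, c 6}"
  have KN: "X = ?N \<union> Z \<union> Y" using XK cyc7_range[OF c] by auto
  have NJ: "\<not> E x y" if "x \<in> ?N" "y \<in> J" for x y
  proof -
    have y: "y \<in> Y" using that JY by blast
    show ?thesis using that(1) Y(5-11)[OF y] by blast
  qed
  have NY: "?N \<inter> Y = {}"
    using Y(2-4) P Q ip jq Y(5,6) by blast
  have ZY: "Z \<inter> Y = {}" using Y(5) by (auto simp: Z_def)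
  have comc: "E (c m) p \<longleftrightarrow> E p (c m)" "E (c m) p' \<longleftrightarrow> E p' (c m)" "E (c m) q \<longleftrightarrow> E q (c m)"
    "E (c m) q' \<longleftrightarrow> E q' (c m)" for m
    using E_commute by blast+
  have com1: "E p i" "E p' i" "E q j" "E q' j" "\<not> E j i" "\<not> E p j" "\<not> E p' j"
    "\<not> E q i" "\<not> E q' i" "\<not> E p' p" "\<not> E q' q" "\<not> E (c m) i" "\<not> E (c m) j" for m
    using ij ip jq P Q pp qq C(4,5) E_sym by blast+
  note adj = com1 comc ij(4) P(5,6) Q(5,6) C(4,5) ip jq pp qq cadj pc qc E_irrefl
  have nee: "p \<noteq> c m" "p' \<noteq> c m" "q \<noteq> c m" "q' \<noteq> c m" "i \<noteq> c m" "j \<noteq> c m" for m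
    using nC Ci by blast+
  have JD: "x \<in> J \<or> (\<exists>s\<in>J. E s x)" if "x \<in> Y" for x using J that by (simp add: mis_def)
  have misSJ: "mis X (S \<union> J)"
    if S: "S \<subseteq> ?N" "indep S" "\<forall>x\<in>?N. x \<in> S \<or> (\<exists>s\<in>S. E s x)" "\<forall>x\<in>Z. \<exists>s\<in>S \<union> J. E s x" for S
    unfolding mis_def
  proof (intro conjI ballI)
    show "S \<union> J \<subseteq> X" using S(1) KN JY(1) by blast
    have "\<not> E x y" "\<not> E y x" if "x \<in> S" "y \<in> J" for x y
      using NJ[OF subsetD[OF S(1) that(1)] that(2)] E_sym by blast+
    then show "indep (S \<union> J)" using S(2) JY(2) unfolding indep_def by blast
    fix x assume "x \<in> X"
    then consider "x \<in> ?N" | "x \<in> Z" | "x \<in> Y" unfolding KN by blast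
    then show "x \<in> S \<union> J \<or> (\<exists>s\<in>S \<union> J. E s x)"
    proof cases
      case 1 from bspec[OF S(3) this] show ?thesis by blast
    next
      case 2 from bspec[OF S(4) this] show ?thesis by blast
    next
      case 3 from JD[OF this] show ?thesis by blast
    qed
  qed
  \<comment> \<open>Independently of \<open>s\<close>, the vertices \<open>i\<close> and
    \<open>j\<close> dominate \<open>p\<close>, \<open>p'\<close>, \<open>q\<close>,
    \<open>q'\<close> and \<open>Z\<close>, and three vertices dominate the cycle.\<close>
  have base: "mis X ({i, j, c 0, c 2, c 4} \<union> J)"
  proof (rule misSJ)
    show "{i, j, c 0, c 2, c 4} \<subseteq> ?N" by blast
    show "indep {i, j, c 0, c 2, c 4}" by (simp add: indep_def adj)
    show "\<forall>x\<in>?N. x \<in> {i, j, c 0, c 2, c 4} \<or> (\<exists>s\<in>{i, j, c 0, c 2, c 4}. E s x)"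
      by (simp add: adj)
    show "\<forall>x\<in>Z. \<exists>s\<in>{i, j, c 0, c 2, c 4} \<union> J. E s x" by (simp add: Z_def)
  qed
  have cb: "card ({i, j, c 0, c 2, c 4} \<union> J) = 5 + card J"
  proof -
    have "{i, j, c 0, c 2, c 4} \<inter> J = {}" using NY JY(1) by blast
    then have "card ({i, j, c 0, c 2, c 4} \<union> J) = card {i, j, c 0, c 2, c 4} + card J"
      using JY(3) by (intro card_Un_disjoint) simp_all
    then show ?thesis using ij(3) nee by (simp add: ceq)
  qed
  have indSJ: "indep (S \<union> J)" if "indep S" "\<And>x y. x \<in> S \<Longrightarrow> y \<in> J \<Longrightarrow> \<not> E x y" for S
    using that JY(2) E_sym unfolding indep_def by blast
  have cardSJ: "card (S \<union> J) = card S + card J" if "S \<subseteq> ?N \<union> Z" for S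
  proof -
    have "S \<inter> J = {}" using that NY ZY JY(1) by blast
    moreover have "finite S" using that KN fin finite_subset[of S X] by blast
    ultimately show ?thesis using JY(3) by (intro card_Un_disjoint) simp_all
  qed
  have small: "card S \<le> 5" if "S \<subseteq> ?N \<union> Z" "indep S" "\<And>x y. x \<in> S \<Longrightarrow> y \<in> J \<Longrightarrow> \<not> E x y" for S
  proof -
    have "S \<union> J \<subseteq> X" using that(1) KN JY(1) by blast
    from indep_card_le[OF wc base this indSJ[OF that(2,3)]] show ?thesis
      using cardSJ[OF that(1)] cb by simp
  qed
  have exact: "card S = 5" if S: "S \<subseteq> ?N" "indep S" "\<forall>x\<in>?N. x \<in> S \<or> (\<exists>s\<in>S. E s x)"
    "\<forall>x\<in>Z. \<exists>s\<in>S \<union> J. E s x" for S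
  proof -
    have "card (S \<union> J) = card ({i, j, c 0, c 2, c 4} \<union> J)"
      using base misSJ[OF S] wc unfolding wc_def by blast
    moreover have "card (S \<union> J) = card S + card J" by (rule cardSJ) (use S(1) in blast)
    ultimately show ?thesis using cb by linarith
  qed
  have far: "\<not> E x y" if "x \<notin> range c" "y \<notin> range c" "E x (c m)" "E y (c n)" "(m - n) mod 7 \<in> {1, 2, 5, 6}" for x y m n
    using attached_adjacent[OF c that(1,2) _ that(3,4)] that(5) by blast
  have Zcom: "E (c m) x \<longleftrightarrow> False" "E x (c m) \<longleftrightarrow> False" "E x p \<longleftrightarrow> E p x" "E x p' \<longleftrightarrow> E p' x" "E x q \<longleftrightarrow> E q x"
    "E x q' \<longleftrightarrow> E q' x" if "x \<in> Z" for x m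
    using Zc[OF that] E_commute by blast+
  consider "s = 0" | "s = 1" | "s = 2" | "s = 3" using s by blast
  then show False
  proof cases
    case 1
    have "c 3 = c 4"
      by (rule common_neighbour_unique[of p' _ q']) (use 1 ne in \<open>simp_all add: adj\<close>)
    then show False by (simp add: ceq)
  next
    case 2
    have n: "\<not> E p q" "\<not> E p q'" "\<not> E p' q" "\<not> E p' q'"
      using far[OF nC(1,3), of 0 1] far[OF nC(1,4), of 0 5] far[OF nC(2,3), of 3 1] far[OF nC(2,4), of 3 4] 2
      by (simp_all add: pc qc)
    then have n': "\<not> E q p" "\<not> E q' p" "\<not> E q p'" "\<not> E q' p'" using E_sym by blast+
    \<comment> \<open>The occupied labels are 0, 3, 4 for \<open>p\<close>, \<open>p'\<close> and 1,
      4, 5 for \<open>q\<close>, \<open>q'\<close>; 2 and 6 are free.\<close>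
    have "card {p, p', q, q', c 2, c 6} \<le> 5"
      by (rule small) (use 2 n n' NJ in \<open>auto simp: indep_def adj\<close>)
    then show False using ne nee by (simp add: ceq)
  next
    case 3
    have n: "\<not> E p q" "\<not> E p q'" "\<not> E p' q" "\<not> E p' q'"
      using far[OF nC(1,3), of 0 2] far[OF nC(1,4), of 0 6] far[OF nC(2,3), of 3 2] far[OF nC(2,4), of 4 5] 3
      by (simp_all add: pc qc)
    then have n': "\<not> E q p" "\<not> E q' p" "\<not> E q p'" "\<not> E q' p'" using E_sym by blast+
    \<comment> \<open>These four vertices dominate all named ones, so some \<open>x\<close> in
      \<open>Z\<close> must escape them and \<open>J\<close>. Two further 4-sets would dominate
      \<open>x\<close> if it were adjacent to \<open>p\<close> or \<open>q\<close>; hence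
      \<open>x\<close>, the four attached vertices and \<open>c 1\<close>, the one free vertex of
      the cycle, are six independent vertices.\<close>
    have no1: "\<exists>x\<in>Z. \<forall>s\<in>{p', q', c 0, c 2} \<union> J. \<not> E s x"
    proof (rule ccontr)
      assume "\<not> ?thesis"
      then have "card {p', q', c 0, c 2} = 5"
        by (intro exact) (use 3 n n' in \<open>auto simp: indep_def adj\<close>)
      then show False using ne nee by (simp add: ceq)
    qed
    then obtain x where x: "x \<in> Z" "\<not> E p' x" "\<not> E q' x" "\<forall>y\<in>J. \<not> E x y" using E_sym by blast
    have px: "\<not> E p x"
    proof
      assume "E p x"
      then have "\<forall>x\<in>Z. \<exists>s\<in>{p, q', c 2, c 4} \<union> J. E s x" using Z1[OF x(1)] by blast
      then have "card {p, q', c 2, c 4} = 5"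
        by (intro exact) (use 3 n n' in \<open>auto simp: indep_def adj\<close>)
      then show False using ne nee by (simp add: ceq)
    qed
    have qx: "\<not> E q x"
    proof
      assume "E q x"
      then have "\<forall>x\<in>Z. \<exists>s\<in>{q, p', c 0, c 5} \<union> J. E s x" using Z1[OF x(1)] by blast
      then have "card {q, p', c 0, c 5} = 5"
        by (intro exact) (use 3 n n' in \<open>auto simp: indep_def adj\<close>)
      then show False using ne nee by (simp add: ceq)
    qed
    have "card {x, p, p', q, q', c 1} \<le> 5"
      by (rule small) (use 3 n n' NJ x px qx in \<open>auto simp: indep_def adj Zcom[OF x(1)]\<close>)
    moreover have "x \<noteq> c 1" using Zne(8)[OF x(1)] by blast
    ultimately show False using ne nee Zne[OF x(1)] by simp
  next
    case 4
    have n: "\<not> E p q'" "\<not> E p' q" "\<not> E p' q'"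
      using far[OF nC(1,4), of 0 6] far[OF nC(2,3), of 4 3] far[OF nC(2,4), of 4 6] 4
      by (simp_all add: pc qc)
    then have n': "\<not> E q' p" "\<not> E q p'" "\<not> E q' p'" using E_sym by blast+
    \<comment> \<open>The attachments of \<open>p\<close> and \<open>q\<close> are at distance
      three, the one pair here whose edge the short cycles do not exclude; without it the free
      vertices \<open>c 1\<close> and \<open>c 5\<close> complete six independent ones.\<close>
    have pq: "E p q"
    proof (rule ccontr)
      assume "\<not> E p q"
      moreover have "\<not> E q p" using calculation E_sym by blast
      ultimately have "card {p, p', q, q', c 1, c 5} \<le> 5"
        by (intro small) (use 4 n n' NJ in \<open>auto simp: indep_def adj\<close>)
      then show False using ne nee by (simp add: ceq)
    qed
    then have qp: "E q p" by (rule E_sym)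
    \<comment> \<open>Such an edge would give the 4-cycle \<open>x\<close>, \<open>p\<close>,
      \<open>q\<close>, \<open>j\<close>.\<close>
    have Zpq: "\<not> E p x" if "x \<in> Z" for x
    proof
      assume "E p x"
      then have "p = j"
        using common_neighbour_unique[of x p q j] that pq jq(1) Zne(4)[OF that] E_sym
        by (simp add: Z_def)
      then show False using P(3) by simp
    qed
    have "\<exists>x\<in>Z. \<forall>s\<in>{p', q, c 1, c 6} \<union> J. \<not> E s x"
    proof (rule ccontr)
      assume "\<not> ?thesis"
      then have "card {p', q, c 1, c 6} = 5"
        by (intro exact) (use 4 n n' pq qp in \<open>auto simp: indep_def adj\<close>)
      then show False using ne nee by (simp add: ceq)
    qed
    then obtain x where x: "x \<in> Z" "\<not> E p' x" "\<forall>y\<in>J. \<not> E x y" using E_sym by blast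
    have qx: "\<not> E q' x"
    proof
      assume "E q' x"
      then have "\<forall>x\<in>Z. \<exists>s\<in>{p, q', c 2, c 4} \<union> J. E s x" using Z1[OF x(1)] by blast
      then have "card {p, q', c 2, c 4} = 5"
        by (intro exact) (use 4 n n' pq qp in \<open>auto simp: indep_def adj\<close>)
      then show False using ne nee by (simp add: ceq)
    qed
    have "card {x, p, p', q', c 1, c 5} \<le> 5"
      by (rule small) (use 4 n n' NJ x Zpq[OF x(1)] qx in \<open>auto simp: indep_def adj Zcom[OF x(1)]\<close>)
    moreover have "x \<noteq> c m" for m using Zne(8)[OF x(1)] by blast
    ultimately show False using ne nee Zne[OF x(1)] by (simp add: ceq)
  qed
qed

text \<open>The left side mentions only vertices and edges, so the opposite edge can be carried over
  to any other labelling of the same cycle, reflections included.\<close>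

lemma cyc7_distance_three:
  assumes c: "cyc7 c"
  shows "(c n \<noteq> c s \<and> \<not> E (c s) (c n) \<and> \<not> (\<exists>z\<in>range c. E (c s) z \<and> E z (c n))) \<longleftrightarrow> (n - s) mod 7 \<in> {3, 4}"
proof -
  define d where "d = (\<lambda>m. c (s + m))"
  have d: "cyc7 d" "range d = range c"
    unfolding d_def using cyc7_shift[OF c] range_shift[of c s] by simp_all
  have "(s + (n - s) mod 7) mod 7 = n mod 7" by (simp add: mod_add_right_eq)
  then have cn: "c n = d ((n - s) mod 7)" "c s = d 0" by (simp_all add: d_def cyc7_eq[OF c])
  show ?thesis
    unfolding cn d(2)[symmetric] cyc7_range[OF d(1)]
    using int_mod7_cases[of "n - s"] by (elim insertE emptyE) (simp_all add: cyc7_eq[OF d(1)] cyc7_adj[OF d(1)])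
qed

lemma opposite_attachment_relabel:
  assumes a: "opposite_attachment X d v q q' 0" and d: "cyc7 d" and c: "cyc7 c" "range d = range c"
  obtains s where "s \<in> {0, 1, 2, 3, 4, 5, 6}" "opposite_attachment X c v q q' s"
proof -
  obtain t where t: "d 0 = c t" using c(2) by (metis rangeE rangeI)
  let ?s = "t mod 7"
  have ms: "(m - t mod 7) mod 7 = (m - t) mod 7" for m by (rule mod_diff_right_eq)
  have 1: "E q (c m) \<longleftrightarrow> (m - ?s) mod 7 = 0" for m
  proof -
    obtain n where n: "c m = d n" using c(2) by (metis rangeE rangeI)
    have "E q (d n) \<longleftrightarrow> d n = d 0"
      using a cyc7_eq[OF d] by (simp add: opposite_attachment_def)
    also have "\<dots> \<longleftrightarrow> m mod 7 = t mod 7" using n t cyc7_eq[OF c(1)] by metis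
    also have "\<dots> \<longleftrightarrow> (m - ?s) mod 7 = 0" unfolding ms by (simp add: mod_eq_dvd_iff dvd_eq_mod_eq_0)
    finally show ?thesis using n by simp
  qed
  have 2: "E q' (c m) \<longleftrightarrow> (m - ?s) mod 7 \<in> {3, 4}" for m
  proof -
    obtain n where n: "c m = d n" using c(2) by (metis rangeE rangeI)
    have "E q' (d n) \<longleftrightarrow> (n - 0) mod 7 \<in> {3, 4}"
      using a by (simp add: opposite_attachment_def)
    also have "\<dots> \<longleftrightarrow> d n \<noteq> d 0 \<and> \<not> E (d 0) (d n) \<and> \<not> (\<exists>z\<in>range d. E (d 0) z \<and> E z (d n))"
      by (rule cyc7_distance_three[OF d, symmetric])
    also have "\<dots> \<longleftrightarrow> c m \<noteq> c t \<and> \<not> E (c t) (c m) \<and> \<not> (\<exists>z\<in>range c. E (c t) z \<and> E z (c m))"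
      by (simp only: n[symmetric] t c(2))
    also have "\<dots> \<longleftrightarrow> (m - t) mod 7 \<in> {3, 4}" by (rule cyc7_distance_three[OF c(1)])
    finally show ?thesis using n ms by simp
  qed
  have h: "q \<in> X" "q' \<in> X" "\<forall>x\<in>X. E v x \<longleftrightarrow> x = q \<or> x = q'"
      "\<forall>x\<in>X. E q x \<or> E q' x \<longrightarrow> x = v \<or> x \<in> range c"
    using a c(2) unfolding opposite_attachment_def by simp_all
  have "opposite_attachment X c v q q' ?s"
    unfolding opposite_attachment_def
  proof (intro conjI)
    show "\<forall>m. E q (c m) \<longleftrightarrow> (m - ?s) mod 7 = 0" using 1 by (rule allI)
    show "\<forall>m. E q' (c m) \<longleftrightarrow> (m - ?s) mod 7 \<in> {3, 4}" using 2 by (rule allI)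
  qed (fact h)+
  then show ?thesis by (rule that[OF int_mod7_cases])
qed

lemma opposite_attachment_shift:
  assumes a: "opposite_attachment X c v p p' t" and s: "(t - r) mod 7 = s mod 7"
  shows "opposite_attachment X (\<lambda>m. c (r + m)) v p p' s"
proof -
  have "(r + m - t) mod 7 = (m - s) mod 7" for m
  proof -
    have "r + m - t = m - (t - r)" by simp
    also have "\<dots> mod 7 = (m - s) mod 7" using s by (intro mod_diff_cong) simp_all
    finally show ?thesis .
  qed
  then show ?thesis using a range_shift[of c r] by (simp add: opposite_attachment_def)
qed

lemma opposite_attachment_exists:
  assumes wc: "wc X" and comp: "cyc7_component (rest X {v}) c" and v: "v \<in> X"
    and u: "u \<in> X" "E v u" "E u (c k)"
  obtains c' p p' where "cyc7 c'" "range c' = range c" "opposite_attachment X c' v p p' 0"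
proof -
  obtain c' p p' where o: "cyc7 c'" "range c' = range c" "p \<in> X" "p' \<in> X" "E v p" "E v p'"
    "p \<noteq> p'" "\<not> E p p'" "\<And>m. E p (c' m) \<longleftrightarrow> m mod 7 = 0" "\<And>m. E p' (c' m) \<longleftrightarrow> m mod 7 \<in> {3, 4}"
    using opposite_pair[OF wc comp v u] by metis
  note t = ten_vertex_component[OF wc cyc7_component_relabel[OF comp o(1,2)] v o(3-10)]
  have "opposite_attachment X c' v p p' 0"
    unfolding opposite_attachment_def using o(3,4,9,10) t by auto
  then show ?thesis using that o(1,2) by blast
qed

lemma not_two_attached_vertices:
  assumes wc: "wc X" and comp: "cyc7_component (rest X {i, j}) c"
    and ij: "i \<in> X" "j \<in> X" "i \<noteq> j" "\<not> E i j"
    and u: "u \<in> rest X {j}" "E i u" "E u (c k)" and w: "w \<in> rest X {i}" "E j w" "E w (c l)"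
  shows False
proof -
  have iX: "i \<in> rest X {j}" and jX: "j \<in> rest X {i}" using ij E_sym by (auto simp: rest_def)
  have r: "rest (rest X {j}) {i} = rest X {i, j}" "rest (rest X {i}) {j} = rest X {i, j}"
    by (auto simp: rest_def)
  then have comps: "cyc7_component (rest (rest X {j}) {i}) c" "cyc7_component (rest (rest X {i}) {j}) c"
    using comp by simp_all
  have wcs: "wc (rest X {j})" "wc (rest X {i})"
    using wc_rest[OF wc, of "{j}"] wc_rest[OF wc, of "{i}"] ij E_irrefl by (simp_all add: indep_def)
  obtain d p p' where d: "cyc7 d" "range d = range c" and P: "opposite_attachment (rest X {j}) d i p p' 0"
    using opposite_attachment_exists[OF wcs(1) comps(1) iX u] by metis
  obtain e q q' where e: "cyc7 e" "range e = range c" and Q0: "opposite_attachment (rest X {i}) e j q q' 0"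
    using opposite_attachment_exists[OF wcs(2) comps(2) jX w] by metis
  obtain s where s: "s \<in> {0, 1, 2, 3, 4, 5, 6}" and Q: "opposite_attachment (rest X {i}) d j q q' s"
    using opposite_attachment_relabel[OF Q0 e(1) d(1)] e(2) d(2) by metis
  have compd: "cyc7_component (rest X {i, j}) d" by (rule cyc7_component_relabel[OF comp d])
  show False
  proof (cases "s \<in> {0, 1, 2, 3}")
    case True
    then show False using not_two_opposite_attachments[OF wc compd ij P Q] by blast
  next
    case False
    \<comment> \<open>Exchanging \<open>i\<close> and \<open>j\<close> replaces the offset
      \<open>s\<close> by \<open>7 - s\<close>, which brings 4, 5, 6 down to 3, 2, 1.\<close>
    define f where "f = (\<lambda>m. d (s + m))"
    have f: "cyc7 f" "range f = range d"
      unfolding f_def using cyc7_shift[OF d(1)] range_shift[of d s] by simp_all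
    have Qf: "opposite_attachment (rest X {i}) f j q q' 0"
      unfolding f_def by (rule opposite_attachment_shift[OF Q]) simp
    have "opposite_attachment (rest X {j}) f i p p' (7 - s)"
      unfolding f_def by (rule opposite_attachment_shift[OF P]) (use s in auto)
    moreover have "7 - s \<in> {0, 1, 2, 3}" using s False by auto
    moreover have "cyc7_component (rest X {j, i}) f"
      using cyc7_component_relabel[OF compd f] by (simp add: insert_commute)
    moreover have "\<not> E j i" using ij(4) E_sym by blast
    ultimately show False using not_two_opposite_attachments[OF wc _ ij(2,1) ij(3)[symmetric] _ Qf] by blast
  qed
qed

section \<open>Deleted sets of least size\<close>

lemma C7_or_ten_vertices:
  assumes wc: "wc V" and I: "I \<subseteq> V" "indep I" "cyc7 c" "range c = rest V I"
    and conn: "\<And>S. S \<subseteq> V \<Longrightarrow> S \<noteq> {} \<Longrightarrow> (\<And>x y. x \<in> S \<Longrightarrow> y \<in> V \<Longrightarrow> E x y \<Longrightarrow> y \<in> S) \<Longrightarrow> S = V"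
  shows "V = range c \<or> (\<exists>d v p p'. cyc7 d \<and> v \<in> V \<and> range d \<subseteq> rest V {v} \<and>
    opposite_attachment V d v p p' 0 \<and> V = {v, p, p'} \<union> range d)"
proof -
  define good where "good I \<longleftrightarrow> I \<subseteq> V \<and> indep I \<and> cyc7_component (rest V I) c" for I
  have "good I" using I by (auto simp: good_def cyc7_component_def)
  then obtain K where K: "good K" and min: "\<And>L. good L \<Longrightarrow> card K \<le> card L"
    using ex_has_least_nat[of good I card] by blast
  have KV: "K \<subseteq> V" "indep K" "cyc7_component (rest V K) c" using K by (auto simp: good_def)
  have fK: "finite K" using KV(1) wc_finite[OF wc] finite_subset by blast
  \<comment> \<open>By minimality, restoring \<open>i\<close> destroys the component, so the cycle
    gains a neighbour \<open>u\<close>. It was removed on account of \<open>i\<close> alone, and it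
    is not \<open>i\<close> itself, which has no neighbour on the cycle.\<close>
  have att: "\<exists>u k. u \<in> rest V (K - {i}) \<and> E i u \<and> E u (c k)" if i: "i \<in> K" for i
  proof -
    have "card (K - {i}) < card K" using i fK by (rule card_Diff1_less[rotated])
    then have "\<not> good (K - {i})" using min by fastforce
    moreover have "K - {i} \<subseteq> V" "indep (K - {i})" using KV by (auto simp: indep_def)
    ultimately have "\<not> cyc7_component (rest V (K - {i})) c" by (simp add: good_def)
    moreover have "range c \<subseteq> rest V (K - {i})"
      using KV(3) by (auto simp: cyc7_component_def rest_def)
    ultimately obtain u m where u: "u \<in> rest V (K - {i})" "E (c m) u" "u \<notin> range c"
      using I(3) by (auto simp: cyc7_component_def)
    have "u \<notin> rest V K" using u KV(3) by (auto simp: cyc7_component_def)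
    then have "u = i \<or> E i u" using u(1) by (auto simp: rest_def)
    moreover have "\<not> E i (c m)" using KV(3) i by (auto simp: cyc7_component_def rest_def)
    ultimately show ?thesis using u E_sym by blast
  qed
  consider "K = {}" | v where "K = {v}" | i j where "i \<in> K" "j \<in> K" "i \<noteq> j" by blast
  then show ?thesis
  proof cases
    case 1
    then have "cyc7_component V c" using KV(3) by (simp add: rest_def)
    then have "range c = V" by (intro conn) (auto simp: cyc7_component_def)
    then show ?thesis by simp
  next
    case (2 v)
    then have v: "v \<in> V" using KV(1) by blast
    have comp: "cyc7_component (rest V {v}) c" using KV(3) 2 by simp
    obtain u k where "u \<in> V" "E v u" "E u (c k)" using att[of v] 2 by (auto simp: rest_def)
    then obtain d p p' where d: "cyc7 d" "range d = range c" and P: "opposite_attachment V d v p p' 0"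
      using opposite_attachment_exists[OF wc comp v] by metis
    have compd: "cyc7_component (rest V {v}) d" by (rule cyc7_component_relabel[OF comp d])
    have dV: "range d \<subseteq> rest V {v}" using compd by (simp add: cyc7_component_def)
    have pV: "p \<in> V" "p' \<in> V" using P by (auto simp: opposite_attachment_def)
    have "{v, p, p'} \<union> range d = V"
    proof (rule conn)
      show "{v, p, p'} \<union> range d \<subseteq> V" using v pV dV rest_subset[of V "{v}"] by blast
      fix x y assume x: "x \<in> {v, p, p'} \<union> range d" and y: "y \<in> V" "E x y"
      have nv: "E v z \<longleftrightarrow> z = p \<or> z = p'" if "z \<in> V" for z
        using P that by (simp add: opposite_attachment_def)
      have np: "z = v \<or> z \<in> range d" if "z \<in> V" "E p z \<or> E p' z" for z
        using P that unfolding opposite_attachment_def by blast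
      consider "x = v" | "x = p \<or> x = p'" | "x \<in> range d" using x by blast
      then show "y \<in> {v, p, p'} \<union> range d"
      proof cases
        case 1 then show ?thesis using nv y by blast
      next
        case 2 then show ?thesis using np y by blast
      next
        case 3
        then have "y \<in> range d" if "y \<in> rest V {v}" using that compd y(2) by (auto simp: cyc7_component_def)
        then show ?thesis using nv y(1) by (auto simp: rest_def)
      qed
    qed simp
    then show ?thesis using d(1) v dV P by metis
  next
    case (3 i j)
    \<comment> \<open>All other vertices of \<open>K\<close> stay deleted. In the remaining
      well-covered graph the cycle is a component once \<open>i\<close> and \<open>j\<close> are
      deleted, and each of them alone still attaches to it.\<close>
    define X where "X = rest V (K - {i, j})"
    have sub: "K - {i, j} \<subseteq> V" "indep (K - {i, j})" using KV by (auto simp: indep_def)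
    have wcX: "wc X" unfolding X_def by (rule wc_rest[OF wc sub])
    have nij: "\<not> E i j" "\<not> E s i" "\<not> E s j" if "s \<in> K" for s using KV(2) 3 that by (auto simp: indep_def)
    have iX: "i \<in> X" "j \<in> X" using 3 KV(1) nij by (auto simp: X_def rest_def)
    have un: "K - {i, j} \<union> {j} = K - {i}" "K - {i, j} \<union> {i} = K - {j}" "K - {i, j} \<union> {i, j} = K"
      using 3 by blast+
    then have r: "rest X {j} = rest V (K - {i})" "rest X {i} = rest V (K - {j})" "rest X {i, j} = rest V K"
      unfolding X_def rest_rest by simp_all
    show ?thesis
      using att[OF 3(1)] att[OF 3(2)] not_two_attached_vertices[OF wcX _ iX 3(3) nij(1)[OF 3(1)]] KV(3)
      unfolding r by metis
  qed
qed

section \<open>Minimal dominating sets\<close>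

text \<open>Minimality is expressed by private neighbours: each d in D is the only member of D that
dominates some vertex x.\<close>

definition min_dom :: "'a set \<Rightarrow> 'a set \<Rightarrow> bool" where
  "min_dom X D \<longleftrightarrow> D \<subseteq> X \<and> (\<forall>x\<in>X. \<exists>d\<in>D. d = x \<or> E d x) \<and>
     (\<forall>d\<in>D. \<exists>x\<in>X. \<forall>e\<in>D. e = x \<or> E e x \<longrightarrow> e = d)"

text \<open>Dominating a representative puts a member of \<open>D\<close> into each simplex. If
  \<open>x\<close> is a private vertex of \<open>d\<close>, the member of \<open>D\<close> found in
  the simplex of \<open>x\<close> dominates \<open>x\<close>, so it is \<open>d\<close> and no other
  member lies there. As the simplices are disjoint, \<open>f\<close> is a bijection from
  \<open>D\<close> onto \<open>P\<close>.\<close>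

lemma min_dom_card_if_covered:
  assumes wc: "wc X" and cov: "simplex_covered X = X"
  shows "\<exists>k. \<forall>D. min_dom X D \<longrightarrow> card D = k"
proof -
  have fin: "finite X" using wc by (rule wc_finite)
  obtain P where P: "P \<subseteq> X" "indep P" "\<And>p. p \<in> P \<Longrightarrow> simplicial X p"
    "simplex_covered X = (\<Union>p\<in>P. nb X p)" "rest X P = X - simplex_covered X"
    using simplicial_representatives[OF fin] by blast
  have misP: "mis X P" using P(1,2,5) cov by (auto simp: mis_def rest_def)
  have cl: "clique (nb X p)" if "p \<in> P" for p using P(3)[OF that] by (simp add: simplicial_def)
  have ex: "\<exists>p\<in>P. x \<in> nb X p" if "x \<in> X" for x using that P(4) cov by blast
  have uniq: "p = p'" if x: "x \<in> nb X p" "x \<in> nb X p'" and p: "p \<in> P" "p' \<in> P" for x p p'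
  proof -
    have "{x} \<subseteq> X" "indep {x}" using x E_irrefl by (auto simp: nb_def indep_def)
    from mis_extend[OF fin this] obtain M where M: "{x} \<subseteq> M" "mis X M" by blast
    show ?thesis by (rule clique_cover(2)[OF wc misP cl ex M(2) _ p x]) (use M in simp_all)
  qed
  have touch: "y = x \<or> E y x" if "p \<in> P" "x \<in> nb X p" "y \<in> nb X p" for p x y
    using cl[OF that(1)] that(2,3) by (auto simp: clique_def)
  have "card D = card P" if D: "min_dom X D" for D
  proof -
    obtain f where f: "\<And>x. x \<in> X \<Longrightarrow> f x \<in> P \<and> x \<in> nb X (f x)" using ex by metis
    have DX: "D \<subseteq> X" using D by (simp add: min_dom_def)
    have hit: "\<exists>d\<in>D. d \<in> nb X p" if "p \<in> P" for p
    proof -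
      have "p \<in> X" using that P(1) by blast
      then obtain d where "d \<in> D" "d = p \<or> E d p" using D by (auto simp: min_dom_def)
      then show ?thesis using DX E_sym by (auto simp: nb_def)
    qed
    have "inj_on f D"
    proof (rule inj_onI)
      fix d e assume de: "d \<in> D" "e \<in> D" "f d = f e"
      have "\<exists>x\<in>X. \<forall>a\<in>D. a = x \<or> E a x \<longrightarrow> a = d" using D de(1) by (simp add: min_dom_def)
      then obtain x where x: "x \<in> X" and "\<forall>a\<in>D. a = x \<or> E a x \<longrightarrow> a = d" by blast
      then have priv: "a = d" if "a \<in> D" "a = x \<or> E a x" for a using that by blast
      have fx: "f x \<in> P" "x \<in> nb X (f x)" using f[OF x] by auto
      obtain r where r: "r \<in> D" "r \<in> nb X (f x)" using hit[OF fx(1)] by blast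
      have "r = d" using priv[OF r(1)] touch[OF fx r(2)] by blast
      moreover have "d \<in> X" "e \<in> X" using de DX by blast+
      ultimately have "f d = f x" using uniq[OF _ r(2)] f fx(1) by blast
      then have "e \<in> nb X (f x)" using f[OF \<open>e \<in> X\<close>] de(3) by simp
      then show "d = e" using priv[OF de(2)] touch[OF fx] by blast
    qed
    moreover have "f ` D = P"
    proof
      show "f ` D \<subseteq> P" using f DX by blast
      show "P \<subseteq> f ` D"
      proof
        fix p assume p: "p \<in> P"
        obtain d where d: "d \<in> D" "d \<in> nb X p" using hit[OF p] by blast
        then have "f d \<in> P" "d \<in> nb X (f d)" using f[of d] DX by blast+
        then have "f d = p" using uniq[OF _ d(2) _ p] by blast
        then show "p \<in> f ` D" using d(1) by blast
      qed
    qed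
    ultimately show ?thesis by (metis card_image)
  qed
  then show ?thesis by blast
qed

section \<open>Minimal dominating sets of the two exceptional graphs\<close>

lemma card_eq_sum_of_bool:
  assumes "finite A" "D \<subseteq> A"
  shows "card D = (\<Sum>x\<in>A. of_bool (x \<in> D))"
proof -
  have "A \<inter> {x. x \<in> D} = D" using assms(2) by blast
  then show ?thesis using assms(1) by (simp add: sum_of_bool_eq)
qed

text \<open>All quantifiers range over \<open>A\<close>, so for an explicitly listed
  \<open>A\<close> they unfold to propositional formulas in the membership statements, in the shape
  of the truth tables.\<close>

lemma min_dom_explicit:
  assumes "min_dom A D"
  shows "\<forall>x\<in>A. \<exists>d\<in>A. d \<in> D \<and> (d = x \<or> E d x)"
    and "\<forall>d\<in>A. d \<in> D \<longrightarrow>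
      (\<exists>x\<in>A. (x = d \<or> E d x) \<and> (\<forall>e\<in>A. (e = x \<or> E e x) \<longrightarrow> e \<noteq> d \<longrightarrow> e \<notin> D))"
proof -
  show dom: "\<forall>x\<in>A. \<exists>d\<in>A. d \<in> D \<and> (d = x \<or> E d x)"
    using assms unfolding min_dom_def by (meson subsetD)
  show "\<forall>d\<in>A. d \<in> D \<longrightarrow>
      (\<exists>x\<in>A. (x = d \<or> E d x) \<and> (\<forall>e\<in>A. (e = x \<or> E e x) \<longrightarrow> e \<noteq> d \<longrightarrow> e \<notin> D))"
  proof (intro ballI impI)
    fix d assume d: "d \<in> A" "d \<in> D"
    then obtain x where x: "x \<in> A" "\<forall>e\<in>D. e = x \<or> E e x \<longrightarrow> e = d"
      using assms unfolding min_dom_def by metis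
    then have "x = d \<or> E d x" using dom by metis
    then show "\<exists>x\<in>A. (x = d \<or> E d x) \<and> (\<forall>e\<in>A. (e = x \<or> E e x) \<longrightarrow> e \<noteq> d \<longrightarrow> e \<notin> D)"
      using x by blast
  qed
qed

text \<open>The variables say which vertices lie in D; the two blocks of hypotheses are domination and the
existence of private neighbours.\<close>

lemma C7_min_dom_truth_table:
  "\<forall>c0 c1 c2 c3 c4 c5 c6.
     (c0 \<or> c1 \<or> c6) \<and> (c0 \<or> c1 \<or> c2) \<and> (c1 \<or> c2 \<or> c3) \<and>
     (c2 \<or> c3 \<or> c4) \<and> (c3 \<or> c4 \<or> c5) \<and> (c4 \<or> c5 \<or> c6) \<and>
     (c0 \<or> c5 \<or> c6) \<longrightarrow>
     (c0 \<longrightarrow> (\<not> c1 \<and> \<not> c6) \<or> (\<not> c1 \<and> \<not> c2) \<or> (\<not> c5 \<and> \<not> c6)) \<and>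
     (c1 \<longrightarrow> (\<not> c0 \<and> \<not> c6) \<or> (\<not> c0 \<and> \<not> c2) \<or> (\<not> c2 \<and> \<not> c3)) \<and>
     (c2 \<longrightarrow> (\<not> c0 \<and> \<not> c1) \<or> (\<not> c1 \<and> \<not> c3) \<or> (\<not> c3 \<and> \<not> c4)) \<and>
     (c3 \<longrightarrow> (\<not> c1 \<and> \<not> c2) \<or> (\<not> c2 \<and> \<not> c4) \<or> (\<not> c4 \<and> \<not> c5)) \<and>
     (c4 \<longrightarrow> (\<not> c2 \<and> \<not> c3) \<or> (\<not> c3 \<and> \<not> c5) \<or> (\<not> c5 \<and> \<not> c6)) \<and>
     (c5 \<longrightarrow> (\<not> c3 \<and> \<not> c4) \<or> (\<not> c4 \<and> \<not> c6) \<or> (\<not> c0 \<and> \<not> c6)) \<and>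
     (c6 \<longrightarrow> (\<not> c0 \<and> \<not> c1) \<or> (\<not> c4 \<and> \<not> c5) \<or> (\<not> c0 \<and> \<not> c5)) \<longrightarrow>
      of_bool c0 + of_bool c1 + of_bool c2 + of_bool c3 + of_bool c4 + of_bool c5 + of_bool c6 = (3 :: nat)"
  by code_simp

text \<open>The edges besides those of the cycle are \<open>v p\<close>, \<open>v p'\<close>,
  \<open>p c0\<close>, \<open>p' c3\<close> and \<open>p' c4\<close>.\<close>

lemma ten_vertices_min_dom_truth_table:
  "\<forall>v p p' c0 c1 c2 c3 c4 c5 c6.
     (v \<or> p \<or> p') \<and> (v \<or> p \<or> c0) \<and> (v \<or> p' \<or> c3 \<or> c4) \<and>
     (p \<or> c0 \<or> c1 \<or> c6) \<and> (c0 \<or> c1 \<or> c2) \<and> (c1 \<or> c2 \<or> c3) \<and>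
     (p' \<or> c2 \<or> c3 \<or> c4) \<and> (p' \<or> c3 \<or> c4 \<or> c5) \<and>
     (c4 \<or> c5 \<or> c6) \<and> (c0 \<or> c5 \<or> c6) \<longrightarrow>
     (v \<longrightarrow> (\<not> p \<and> \<not> p') \<or> (\<not> p \<and> \<not> c0) \<or> (\<not> p' \<and> \<not> c3 \<and> \<not> c4)) \<and>
     (p \<longrightarrow> (\<not> v \<and> \<not> p') \<or> (\<not> v \<and> \<not> c0) \<or> (\<not> c0 \<and> \<not> c1 \<and> \<not> c6)) \<and>
     (p' \<longrightarrow> (\<not> v \<and> \<not> p) \<or> (\<not> v \<and> \<not> c3 \<and> \<not> c4) \<or> (\<not> c2 \<and> \<not> c3 \<and> \<not> c4) \<or> (\<not> c3 \<and> \<not> c4 \<and> \<not> c5)) \<and>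
     (c0 \<longrightarrow> (\<not> v \<and> \<not> p) \<or> (\<not> p \<and> \<not> c1 \<and> \<not> c6) \<or> (\<not> c1 \<and> \<not> c2) \<or> (\<not> c5 \<and> \<not> c6)) \<and>
     (c1 \<longrightarrow> (\<not> p \<and> \<not> c0 \<and> \<not> c6) \<or> (\<not> c0 \<and> \<not> c2) \<or> (\<not> c2 \<and> \<not> c3)) \<and>
     (c2 \<longrightarrow> (\<not> c0 \<and> \<not> c1) \<or> (\<not> c1 \<and> \<not> c3) \<or> (\<not> p' \<and> \<not> c3 \<and> \<not> c4)) \<and>
     (c3 \<longrightarrow> (\<not> v \<and> \<not> p' \<and> \<not> c4) \<or> (\<not> c1 \<and> \<not> c2) \<or> (\<not> p' \<and> \<not> c2 \<and> \<not> c4) \<or> (\<not> p' \<and> \<not> c4 \<and> \<not> c5)) \<and>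
     (c4 \<longrightarrow> (\<not> v \<and> \<not> p' \<and> \<not> c3) \<or> (\<not> p' \<and> \<not> c2 \<and> \<not> c3) \<or> (\<not> p' \<and> \<not> c3 \<and> \<not> c5) \<or> (\<not> c5 \<and> \<not> c6)) \<and>
     (c5 \<longrightarrow> (\<not> p' \<and> \<not> c3 \<and> \<not> c4) \<or> (\<not> c4 \<and> \<not> c6) \<or> (\<not> c0 \<and> \<not> c6)) \<and>
     (c6 \<longrightarrow> (\<not> p \<and> \<not> c0 \<and> \<not> c1) \<or> (\<not> c4 \<and> \<not> c5) \<or> (\<not> c0 \<and> \<not> c5)) \<longrightarrow>
      of_bool v + of_bool p + of_bool p' + of_bool c0 + of_bool c1 + of_bool c2 + of_bool c3 + of_bool c4 + of_bool c5 + of_bool c6 = (4 :: nat)"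
  by code_simp

lemma min_dom_card_C7:
  assumes c: "cyc7 c" and D: "min_dom (range c) D"
  shows "card D = 3"
proof -
  note A = cyc7_range[OF c]
  have "D \<subseteq> range c" using D by (simp add: min_dom_def)
  then have "card D = (\<Sum>x\<in>range c. of_bool (x \<in> D))"
    by (intro card_eq_sum_of_bool) (simp_all add: A)
  then have card: "card D = of_bool (c 0 \<in> D) + of_bool (c 1 \<in> D) + of_bool (c 2 \<in> D) + of_bool (c 3 \<in> D)
      + of_bool (c 4 \<in> D) + of_bool (c 5 \<in> D) + of_bool (c 6 \<in> D)"
    unfolding A by (simp add: cyc7_eq[OF c])
  show ?thesis
    unfolding card
    by (rule C7_min_dom_truth_table[rule_format])
      (use min_dom_explicit(1)[OF D] in \<open>simp add: A cyc7_eq[OF c] cyc7_adj[OF c]\<close>,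
       use min_dom_explicit(2)[OF D] in \<open>simp add: A cyc7_eq[OF c] cyc7_adj[OF c]\<close>)
qed

lemma min_dom_card_ten:
  assumes c: "cyc7 c" and at: "opposite_attachment V c v p p' 0" and v: "range c \<subseteq> rest V {v}"
    and V: "V = {v, p, p'} \<union> range c" and D: "min_dom V D"
  shows "card D = 4"
proof -
  have vV: "v \<in> V" using V by blast
  have nC: "v \<noteq> c m" "\<not> E v (c m)" "\<not> E (c m) v" for m
    using v E_sym by (auto simp: rest_def)
  have pV: "p \<in> V" "p' \<in> V" and nv: "\<And>x. x \<in> V \<Longrightarrow> E v x \<longleftrightarrow> x = p \<or> x = p'"
    using at unfolding opposite_attachment_def by blast+
  have pc: "E p (c m) \<longleftrightarrow> m mod 7 = 0" "E p' (c m) \<longleftrightarrow> m mod 7 \<in> {3, 4}" for m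
    using at by (simp_all add: opposite_attachment_def)
  have cp: "E (c m) p \<longleftrightarrow> m mod 7 = 0" "E (c m) p' \<longleftrightarrow> m mod 7 \<in> {3, 4}" for m
    using pc[of m] E_commute[of "c m" p] E_commute[of "c m" p'] by simp_all
  have vp: "E v p" "E v p'" using nv pV by blast+
  then have pv: "E p v" "E p' v" using E_sym by blast+
  have nep: "p \<noteq> c m" "p' \<noteq> c m" for m using vp nC(2) by blast+
  have ne: "v \<noteq> p" "v \<noteq> p'" "p \<noteq> p'" using vp pc[of 0] E_irrefl by auto
  have in_p: "x = v \<or> x \<in> range c" if "x \<in> V" "E p x" for x
    using at that unfolding opposite_attachment_def by blast
  have pp: "\<not> E p p'" "\<not> E p' p" using in_p[of p'] pV ne nep E_sym by blast+
  have A: "V = {v, p, p', c 0, c 1, c 2, c 3, c 4, c 5, c 6}" unfolding V cyc7_range[OF c] by blast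
  note adj = cyc7_eq[OF c] cyc7_adj[OF c] nC nC(1)[symmetric] pc cp vp pv nep nep[symmetric] ne ne[symmetric] pp E_irrefl
  have "D \<subseteq> V" using D by (simp add: min_dom_def)
  then have "card D = (\<Sum>x\<in>V. of_bool (x \<in> D))"
    by (intro card_eq_sum_of_bool) (simp_all add: A)
  then have card: "card D = of_bool (v \<in> D) + of_bool (p \<in> D) + of_bool (p' \<in> D) + of_bool (c 0 \<in> D)
      + of_bool (c 1 \<in> D) + of_bool (c 2 \<in> D) + of_bool (c 3 \<in> D)
      + of_bool (c 4 \<in> D) + of_bool (c 5 \<in> D) + of_bool (c 6 \<in> D)"
    unfolding A by (simp add: adj)
  show ?thesis
    unfolding card
    by (rule ten_vertices_min_dom_truth_table[rule_format])
      (use min_dom_explicit(1)[OF D] in \<open>simp add: A adj\<close>,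
       use min_dom_explicit(2)[OF D] in \<open>simp add: A adj\<close>)
qed

end

section \<open>Transfer to the graph and its stated properties\<close>

theorem mainTheorem1:
  fixes V :: "'a set" and E :: "'a \<Rightarrow> 'a \<Rightarrow> bool"
  assumes "simple_graph V E" and "connected_graph V E"
    and "\<not> has_C4 V E" and "\<not> has_C5 V E"
  shows "well_dominated V E \<longleftrightarrow> well_covered V E"
proof -
  have fin: "finite V" and EV: "\<And>u v. E u v \<Longrightarrow> u \<in> V \<and> v \<in> V"
    and sy: "\<And>u v. E u v \<Longrightarrow> E v u" and ir: "\<And>v. \<not> E v v"
    using assms(1) by (auto simp: simple_graph_def)
  interpret c45_free E
  proof
    show "E v u" if "E u v" for u v using sy that .
    show "\<not> E v v" for v by (rule ir)
    show "b = d" if h: "E a b" "E b c" "E c d" "E d a" "a \<noteq> c" for a b c d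
    proof (rule ccontr)
      assume "b \<noteq> d"
      then have "distinct [a, b, c, d]" using h ir by auto
      moreover have "{a, b, c, d} \<subseteq> V" using h EV by blast
      ultimately show False using assms(3) h unfolding has_C4_def by blast
    qed
    show False if h: "E a b" "E b c" "E c d" "E d e" "E e a" "distinct [a, b, c, d, e]" for a b c d e
    proof -
      have "{a, b, c, d, e} \<subseteq> V" using h EV by blast
      then show False using assms(4) h unfolding has_C5_def by blast
    qed
  qed
  have mi: "maximal_independent V E S \<longleftrightarrow> mis V S" for S
  proof
    assume S: "maximal_independent V E S"
    then have S': "S \<subseteq> V" "indep S" by (auto simp: maximal_independent_def independent_def indep_def)
    obtain M where M: "S \<subseteq> M" "mis V M" using mis_extend[OF fin S'] .
    then have "independent V E M" by (auto simp: mis_def indep_def independent_def)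
    then have "M = S" using S M(1) by (simp add: maximal_independent_def)
    then show "mis V S" using M(2) by simp
  next
    assume S: "mis V S"
    have "T = S" if T: "independent V E T" "S \<subseteq> T" for T
    proof -
      have "x \<in> S" if "x \<in> T" for x
        using that S T unfolding mis_def independent_def by blast
      then show ?thesis using T(2) by blast
    qed
    then show "maximal_independent V E S"
      using S by (auto simp: maximal_independent_def independent_def mis_def indep_def)
  qed
  have wc: "well_covered V E \<longleftrightarrow> wc V"
    using fin unfolding well_covered_def wc_def mi by blast
  have md1: "minimal_dominating V E S" if S: "mis V S" for S
    unfolding minimal_dominating_def
  proof (intro conjI allI impI notI)
    show "dominating V E S" using S unfolding dominating_def mis_def by blast
    fix T assume T: "T \<subset> S" "dominating V E T"
    then obtain x where x: "x \<in> S" "x \<notin> T" by blast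
    then have "x \<in> V" using S by (auto simp: mis_def)
    then obtain u where "u \<in> T" "E u x" using T(2) x(2) by (auto simp: dominating_def)
    then show False using T(1) x(1) S unfolding mis_def indep_def by blast
  qed
  have md2: "min_dom V D" if D: "minimal_dominating V E D" for D
    unfolding min_dom_def
  proof (intro conjI ballI)
    have dom: "D \<subseteq> V" "\<And>x. x \<in> V \<Longrightarrow> x \<in> D \<or> (\<exists>u\<in>D. E u x)"
      using D by (auto simp: minimal_dominating_def dominating_def)
    show "D \<subseteq> V" by (rule dom(1))
    show "\<exists>d\<in>D. d = x \<or> E d x" if "x \<in> V" for x using dom(2)[OF that] by blast
    fix d assume d: "d \<in> D"
    then have "D - {d} \<subset> D" by blast
    then have "\<not> dominating V E (D - {d})" using D by (simp add: minimal_dominating_def)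
    \<comment> \<open>The vertex that loses its domination when \<open>d\<close> is removed is
      private to \<open>d\<close>; it may be \<open>d\<close> itself.\<close>
    then obtain x where x: "x \<in> V" "x \<notin> D - {d}" "\<not> (\<exists>u\<in>D - {d}. E u x)"
      using dom(1) unfolding dominating_def by blast
    then have "\<forall>e\<in>D. e = x \<or> E e x \<longrightarrow> e = d" by blast
    then show "\<exists>x\<in>V. \<forall>e\<in>D. e = x \<or> E e x \<longrightarrow> e = d" using x(1) by blast
  qed
  \<comment> \<open>Connectivity is put in closure form because the cycle and the ten vertices are
    each recognised by having no edge that leaves them.\<close>
  have conn: "S = V" if S: "S \<subseteq> V" "S \<noteq> {}" "\<And>x y. x \<in> S \<Longrightarrow> y \<in> V \<Longrightarrow> E x y \<Longrightarrow> y \<in> S" for S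
  proof -
    obtain s where s: "s \<in> S" using S(2) by blast
    have "v \<in> S" if "v \<in> V" for v
    proof -
      have "(s, v) \<in> {(x, y). E x y}\<^sup>*"
        using assms(2) s S(1) that unfolding connected_graph_def by blast
      then show ?thesis
      proof induction
        case base show ?case by (rule s)
      next
        case (step y z)
        then have "E y z" by simp
        then show ?case using S(3)[OF step.IH] EV by blast
      qed
    qed
    then show ?thesis using S(1) by blast
  qed
  show ?thesis
  proof
    assume wd: "well_dominated V E"
    have "card S = card T" if "mis V S" "mis V T" for S T
      using wd md1[OF that(1)] md1[OF that(2)] unfolding well_dominated_def by blast
    then show "well_covered V E" unfolding wc wc_def using fin by blast
  next
    assume "well_covered V E"
    then have wcV: "wc V" using wc by simp
    have "\<exists>k. \<forall>D. min_dom V D \<longrightarrow> card D = k"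
    proof (cases "simplex_covered V = V")
      case True then show ?thesis by (rule min_dom_card_if_covered[OF wcV])
    next
      case False
      then obtain I c where I: "I \<subseteq> V" "indep I" "cyc7 c" "range c = rest V I"
        using simplex_covered_or_C7[OF wcV] by blast
      from C7_or_ten_vertices[OF wcV I conn]
      consider "V = range c" | d v p p' where "cyc7 d" "range d \<subseteq> rest V {v}"
        "opposite_attachment V d v p p' 0" "V = {v, p, p'} \<union> range d"
        by blast
      then show ?thesis
      proof cases
        case 1 then show ?thesis using min_dom_card_C7[OF I(3)] by blast
      next
        case 2 then show ?thesis using min_dom_card_ten[OF 2(1,3,2,4)] by blast
      qed
    qed
    then obtain k where "\<And>D. min_dom V D \<Longrightarrow> card D = k" by blast
    then show "well_dominated V E" unfolding well_dominated_def using md2 by metis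
  qed
qed

end
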